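(* Let $\beta>0$, $h\ge 0$, and let $h_1,h_2,\ldots$ be any sequence of (deterministic) vectors with $h_N\in\mathbb{R}^N$ and $|h_N|=h$ for all $N$. Then $$\left|\frac1N\sup_{m\in\mathbb{R}^N:\,|m|<1,\ \beta(m)\le\frac{1}{\sqrt2}}H_{TAP}(m)-\sup_{q\in[0,1]:\,\beta(1-q)\le\frac1{\sqrt2}}\mathcal{B}(q)\right|\longrightarrow0\quad\text{in probability as }N\to\infty,$$ where $$\mathcal{B}(q)=\sqrt{h^2q+2\beta^2q^2}+\frac12\log(1-q)+\frac{\beta^2}{2}(1-q)^2 .$$
   Context: Let $J_{ij}$, $i,j\ge1$, be iid standard Gaussian random variables on a probability space $(\Omega,\mathcal{A},\mathbb{P})$, and for $\sigma\in\mathbb{R}^N$ let $H_N(\sigma)=\sqrt N\sum_{i,j=1}^N J_{ij}\sigma_i\sigma_j$. $|\cdot|$ is the Euclidean norm. For $m\in\mathbb{R}^N$ with $|m|<1$ the TAP free energy is $$H_{TAP}(m)=\beta H_N(m)+N m\cdot h_N+\frac N2\log(1-|m|^2)+N\frac{\beta^2}{2}(1-|m|^2)^2,$$ and $\beta(m)=\beta(1-|m|^2)$. The convention $\log 0=-\infty$ is used, so $\mathcal{B}(1)=-\infty$. *)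

theory Defs
  imports "HOL-Probability.Probability"
begin

text \<open>The dimension \<open>N\<close> varies inside the statement, so a vector of \<open>\<real>\<^sup>N\<close> is a function that is
  extensional on its index set \<open>{1..N}\<close>.\<close>

definition Rn :: "nat \<Rightarrow> (nat \<Rightarrow> real) set" where
  "Rn N = {1..N} \<rightarrow>\<^sub>E UNIV"

definition dotp :: "nat \<Rightarrow> (nat \<Rightarrow> real) \<Rightarrow> (nat \<Rightarrow> real) \<Rightarrow> real" where
  "dotp N x y = (\<Sum>i=1..N. x i * y i)"

abbreviation enorm :: "nat \<Rightarrow> (nat \<Rightarrow> real) \<Rightarrow> real" where
  "enorm N x \<equiv> L2_set x {1..N}"

text \<open>The array \<open>J\<close> is here one realisation of the disorder.\<close>

definition Ham :: "(nat \<Rightarrow> nat \<Rightarrow> real) \<Rightarrow> nat \<Rightarrow> (nat \<Rightarrow> real) \<Rightarrow> real" where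
  "Ham J N \<sigma> = sqrt (real N) * (\<Sum>i=1..N. \<Sum>j=1..N. J i j * \<sigma> i * \<sigma> j)"

text \<open>Only meaningful for \<open>enorm N m < 1\<close>, where the argument of the logarithm is positive.\<close>

definition H_TAP :: "real \<Rightarrow> (nat \<Rightarrow> nat \<Rightarrow> real) \<Rightarrow> nat \<Rightarrow> (nat \<Rightarrow> real) \<Rightarrow> (nat \<Rightarrow> real) \<Rightarrow> real" where
  "H_TAP \<beta> J N hN m =
     \<beta> * Ham J N m + real N * dotp N m hN
     + real N / 2 * ln (1 - (enorm N m)\<^sup>2)
     + real N * (\<beta>\<^sup>2 / 2) * (1 - (enorm N m)\<^sup>2)\<^sup>2"

definition beta_eff :: "real \<Rightarrow> nat \<Rightarrow> (nat \<Rightarrow> real) \<Rightarrow> real" where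
  "beta_eff \<beta> N m = \<beta> * (1 - (enorm N m)\<^sup>2)"

text \<open>The library has \<open>ln 0 = 0\<close> on the reals; here \<open>log 0 = -\<infinity>\<close>.\<close>

definition log_ext :: "real \<Rightarrow> ereal" where
  "log_ext x = (if x = 0 then - \<infinity> else ereal (ln x))"

definition B_TAP :: "real \<Rightarrow> real \<Rightarrow> real \<Rightarrow> ereal" where
  "B_TAP \<beta> h q =
     ereal (sqrt (h\<^sup>2 * q + 2 * \<beta>\<^sup>2 * q\<^sup>2)) + ereal (1 / 2) * log_ext (1 - q)
     + ereal (\<beta>\<^sup>2 / 2 * (1 - q)\<^sup>2)"

text \<open>Measurability is part of the definition because \<^const>\<open>measure\<close> is \<open>0\<close> on non-measurable sets.\<close>

definition tendsto_zero_in_prob :: "'a measure \<Rightarrow> (nat \<Rightarrow> 'a \<Rightarrow> ereal) \<Rightarrow> bool" where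
  "tendsto_zero_in_prob M Y \<longleftrightarrow>
     (\<forall>N. Y N \<in> borel_measurable M) \<and>
     (\<forall>\<epsilon>::real. \<epsilon> > 0 \<longrightarrow>
        (\<lambda>N. measure M {\<omega> \<in> space M. \<bar>Y N \<omega>\<bar> > ereal \<epsilon>}) \<longlonglongrightarrow> 0)"

end

theory Submission
  imports Defs
begin

text \<open>
  Write \<open>Q(m)\<close> for the form \<open>\<Sum> J\<^sub>i\<^sub>j m\<^sub>i m\<^sub>j\<close>, so that \<open>\<beta> H\<^sub>N(m) / N = \<beta> Q(m) / sqrt N\<close>. For fixed \<open>q = \<bar>m\<bar>\<^sup>2\<close> the last
  two terms of the TAP free energy are constant, and one has to show that the maximum of
  \<open>\<beta> Q(m) / sqrt N + m \<cdot> h\<^sub>N\<close> over \<open>\<bar>m\<bar>\<^sup>2 = q\<close> is close to \<open>f(h, q) = sqrt (h\<^sup>2 q + 2 \<beta>\<^sup>2 q\<^sup>2)\<close>.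

  The reason is a fixed point equation. The law of \<open>J\<close> is invariant under rotations, so the field may be
  assumed to point along the first axis. With \<open>m = (m\<^sub>1, m')\<close>, the form \<open>Q(m)\<close> is \<open>J\<^sub>1\<^sub>1 m\<^sub>1\<^sup>2 + m\<^sub>1 (w \<cdot> m') + Q'(m')\<close>,
  where \<open>w\<close> is the sum of the rest of the first row and column. Here \<open>J\<^sub>1\<^sub>1\<close> is
  negligible, \<open>w\<close> has length about \<open>sqrt (2 N)\<close> and is independent of \<open>Q'\<close>. So \<open>m'\<close> sees the same problem in one
  dimension less with a field of strength \<open>sqrt 2 \<beta> m\<^sub>1\<close>, and \<open>f(h, q)\<close> is the maximum over \<open>m\<^sub>1\<close> of
  \<open>h m\<^sub>1 + f(sqrt 2 \<beta> m\<^sub>1, q - m\<^sub>1\<^sup>2)\<close>, by the Cauchy-Schwarz inequality in the plane. Iterating this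
  is the reduction of \<open>J + J\<^sup>T\<close> to tridiagonal form.

  For the upper bound (\<open>upper_dominated_step\<close>, \<open>upper_dominated_prob\<close>) the iteration runs through all \<open>N\<close>
  coordinates. The invariant \<open>Q(m) \<le> \<kappa> \<bar>m\<bar> \<bar>m\<^sub>\<bottom>\<bar> + \<epsilon> \<bar>m\<bar>\<^sup>2\<close>, with \<open>m\<^sub>\<bottom>\<close> the part of \<open>m\<close> orthogonal to the field,
  is reproduced without loss, and the exceptional events, that \<open>w\<close> is too long or \<open>J\<^sub>1\<^sub>1\<close> too large, have
  exponentially small probability, so that \<open>N\<close> of them are harmless.

  For the lower bound (\<open>lower_witness_step\<close>, \<open>lower_witness_prob\<close>) one vector at one nearly optimal \<open>q\<close> is
  enough. The optimal \<open>m\<close> makes the same angle with the field at every stage of the iteration, so if \<open>a\<close> and \<open>b\<close>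
  are the cosine and sine of this angle, it has the coordinates \<open>a, a b, a b\<^sup>2, \<dots>\<close> up to the factor \<open>sqrt q\<close>. Stopping
  after \<open>k\<close> steps costs a relative error \<open>b ^ (2 k)\<close>.

  The induction is carried out for arbitrary finite index sets, so that deleting a coordinate needs no
  renumbering. Both bounds are stated as properties of \<open>J\<close> that are
  invariant under rotations and measurable, which lets \<open>measure_le_by_axis_reduction\<close> and
  \<open>measure_le_by_peeling\<close> do the two probabilistic steps, rotation and conditioning, separately.
\<close>

section \<open>Rotation invariance of the Gaussian product measure\<close>

definition gauss :: "real measure" where
  "gauss = density lborel (\<lambda>x. ennreal (std_normal_density x))"

lemma sets_gauss [measurable_cong, simp]: "sets gauss = sets borel"
  and space_gauss [simp]: "space gauss = UNIV"
  by (simp_all add: gauss_def)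

interpretation gauss: prob_space gauss
  unfolding gauss_def by (rule prob_space_normal_density) simp

interpretation gauss_prod: product_prob_space "\<lambda>_::'k. gauss" UNIV
  by standard

lemma prob_space_gauss_PiM: "prob_space (PiM X (\<lambda>_. gauss))"
  by (rule prob_space_PiM) (rule gauss.prob_space_axioms)

text \<open>The vector \<open>x\<close> turned in the plane of the coordinates \<open>p\<close> and \<open>q\<close> when
  \<open>c\<^sup>2 + s\<^sup>2 = 1\<close>. The index type is arbitrary because the same map acts on vectors and on the entries
  of a matrix.\<close>

definition rotate :: "real \<Rightarrow> real \<Rightarrow> 'k \<Rightarrow> 'k \<Rightarrow> ('k \<Rightarrow> real) \<Rightarrow> 'k \<Rightarrow> real" where
  "rotate c s p q x = x(p := c * x p + s * x q, q := - s * x p + c * x q)"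

text \<open>For \<open>c \<noteq> 0\<close> a plane rotation factors into two one-dimensional affine substitutions:
  \<open>a = c u + s v\<close> in \<open>u\<close> for fixed \<open>v\<close>, then \<open>b = (v - s a) / c\<close> in \<open>v\<close> for fixed \<open>a\<close>. Their Jacobians
  \<open>1 / \<bar>c\<bar>\<close> and \<open>\<bar>c\<bar>\<close> cancel.\<close>

lemma nn_integral_lborel_rotate:
  fixes f :: "real \<times> real \<Rightarrow> ennreal"
  assumes cs: "c\<^sup>2 + s\<^sup>2 = 1" and c: "c \<noteq> 0" and f [measurable]: "f \<in> borel_measurable borel"
  shows "(\<integral>\<^sup>+v. \<integral>\<^sup>+u. f (c * u + s * v, - s * u + c * v) \<partial>lborel \<partial>lborel)
       = (\<integral>\<^sup>+v. \<integral>\<^sup>+u. f (u, v) \<partial>lborel \<partial>lborel)"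
proof -
  have [measurable]: "f \<in> borel_measurable (borel \<Otimes>\<^sub>M borel)"
    using f by (simp add: borel_prod)
  define k where "k = ennreal \<bar>c\<bar>"
  have k: "k \<noteq> 0" "k \<noteq> \<infinity>" using c by (auto simp: k_def)
  have inner: "k * (\<integral>\<^sup>+u. f (c * u + s * v, - s * u + c * v) \<partial>lborel)
      = (\<integral>\<^sup>+a. f (a, (v - s * a) / c) \<partial>lborel)" for v
  proof -
    have eq: "(s * v + c * u, (v - s * (s * v + c * u)) / c) = (c * u + s * v, - s * u + c * v)" for u
    proof -
      have "v - s * (s * v + c * u) = c * (- s * u + c * v) + (1 - (c\<^sup>2 + s\<^sup>2)) * v"
        by (simp add: algebra_simps power2_eq_square)
      then show ?thesis using c cs by (simp add: field_simps)
    qed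
    have "(\<integral>\<^sup>+a. f (a, (v - s * a) / c) \<partial>lborel)
        = k * (\<integral>\<^sup>+u. f (s * v + c * u, (v - s * (s * v + c * u)) / c) \<partial>lborel)"
      unfolding k_def by (rule nn_integral_real_affine) (use c in simp_all)
    then show ?thesis by (simp only: eq)
  qed
  have outer: "(\<integral>\<^sup>+v. f (a, (v - s * a) / c) \<partial>lborel) = k * (\<integral>\<^sup>+v. f (a, v) \<partial>lborel)" for a
  proof -
    have "(\<integral>\<^sup>+v. f (a, (v - s * a) / c) \<partial>lborel)
        = k * (\<integral>\<^sup>+v. f (a, (s * a + c * v - s * a) / c) \<partial>lborel)"
      unfolding k_def by (rule nn_integral_real_affine) (use c in simp_all)
    then show ?thesis using c by simp
  qed
  have "k * (\<integral>\<^sup>+v. \<integral>\<^sup>+u. f (c * u + s * v, - s * u + c * v) \<partial>lborel \<partial>lborel)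
      = (\<integral>\<^sup>+v. \<integral>\<^sup>+a. f (a, (v - s * a) / c) \<partial>lborel \<partial>lborel)"
    by (subst nn_integral_cmult [symmetric]) (simp, simp only: inner)
  also have "\<dots> = (\<integral>\<^sup>+a. \<integral>\<^sup>+v. f (a, (v - s * a) / c) \<partial>lborel \<partial>lborel)"
    by (rule lborel_pair.Fubini') simp
  also have "\<dots> = k * (\<integral>\<^sup>+a. \<integral>\<^sup>+v. f (a, v) \<partial>lborel \<partial>lborel)"
    by (simp add: outer nn_integral_cmult)
  also have "(\<integral>\<^sup>+a. \<integral>\<^sup>+v. f (a, v) \<partial>lborel \<partial>lborel) = (\<integral>\<^sup>+v. \<integral>\<^sup>+a. f (a, v) \<partial>lborel \<partial>lborel)"
    by (rule lborel_pair.Fubini' [symmetric]) simp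
  finally show ?thesis using k by (simp add: ennreal_mult_cancel_left)
qed

text \<open>The product density depends on \<open>u\<^sup>2 + v\<^sup>2\<close> only, which a rotation does not change.\<close>

lemma nn_integral_gauss_rotate:
  fixes f :: "real \<times> real \<Rightarrow> ennreal"
  assumes cs: "c\<^sup>2 + s\<^sup>2 = 1" and c: "c \<noteq> 0" and f [measurable]: "f \<in> borel_measurable borel"
  shows "(\<integral>\<^sup>+v. \<integral>\<^sup>+u. f (c * u + s * v, - s * u + c * v) \<partial>gauss \<partial>gauss)
       = (\<integral>\<^sup>+v. \<integral>\<^sup>+u. f (u, v) \<partial>gauss \<partial>gauss)"
proof -
  have [measurable]: "f \<in> borel_measurable (borel \<Otimes>\<^sub>M borel)"
    using f by (simp add: borel_prod)
  define g where "g = (\<lambda>(u, v). ennreal (std_normal_density u * std_normal_density v) * f (u, v))"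
  have g: "g \<in> borel_measurable borel"
    unfolding g_def by (subst borel_prod [symmetric]) measurable
  have dens: "std_normal_density (c * u + s * v) * std_normal_density (- s * u + c * v)
      = std_normal_density u * std_normal_density v" for u v
  proof -
    have "(c * u + s * v)\<^sup>2 + (- s * u + c * v)\<^sup>2 = (c\<^sup>2 + s\<^sup>2) * (u\<^sup>2 + v\<^sup>2)"
      by (simp add: algebra_simps power2_eq_square)
    then have "- ((c * u + s * v)\<^sup>2 / 2) + - ((- s * u + c * v)\<^sup>2 / 2) = - (u\<^sup>2 / 2) + - (v\<^sup>2 / 2)"
      using cs by (simp add: field_simps)
    then show ?thesis
      by (simp add: std_normal_density_def mult_exp_exp del: exp_add)
  qed
  have unfold: "(\<integral>\<^sup>+v. \<integral>\<^sup>+u. F (u, v) \<partial>gauss \<partial>gauss) = (\<integral>\<^sup>+v. \<integral>\<^sup>+u.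
      ennreal (std_normal_density u * std_normal_density v) * F (u, v) \<partial>lborel \<partial>lborel)"
    if [measurable]: "F \<in> borel_measurable (borel \<Otimes>\<^sub>M borel)" for F
  proof -
    have "(\<integral>\<^sup>+v. \<integral>\<^sup>+u. F (u, v) \<partial>gauss \<partial>gauss) = (\<integral>\<^sup>+v. ennreal (std_normal_density v) *
        (\<integral>\<^sup>+u. ennreal (std_normal_density u) * F (u, v) \<partial>lborel) \<partial>lborel)"
      unfolding gauss_def by (subst nn_integral_density; simp add: nn_integral_density)
    also have "\<dots> = (\<integral>\<^sup>+v. \<integral>\<^sup>+u.
      ennreal (std_normal_density u * std_normal_density v) * F (u, v) \<partial>lborel \<partial>lborel)"
      by (intro nn_integral_cong, subst nn_integral_cmult [symmetric])
        (simp_all add: ennreal_mult mult_ac)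
    finally show ?thesis .
  qed
  have "(\<integral>\<^sup>+v. \<integral>\<^sup>+u. f (c * u + s * v, - s * u + c * v) \<partial>gauss \<partial>gauss)
      = (\<integral>\<^sup>+v. \<integral>\<^sup>+u. g (c * u + s * v, - s * u + c * v) \<partial>lborel \<partial>lborel)"
    using unfold [of "\<lambda>(u, v). f (c * u + s * v, - s * u + c * v)"] by (simp only: g_def dens prod.case) simp
  also have "\<dots> = (\<integral>\<^sup>+v. \<integral>\<^sup>+u. g (u, v) \<partial>lborel \<partial>lborel)"
    by (rule nn_integral_lborel_rotate [OF cs c g])
  also have "\<dots> = (\<integral>\<^sup>+v. \<integral>\<^sup>+u. f (u, v) \<partial>gauss \<partial>gauss)"
    by (simp add: unfold g_def)
  finally show ?thesis .
qed

lemma measurable_rotate [measurable]: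
  assumes "p \<in> X" "q \<in> X"
  shows "rotate c s p q \<in> PiM X (\<lambda>_. gauss) \<rightarrow>\<^sub>M PiM X (\<lambda>_. gauss)"
proof -
  have X: "X = X \<union> {p}" "X = X \<union> {q}" using assms by auto
  have [measurable]: "(\<lambda>x. x r) \<in> PiM X (\<lambda>_. gauss) \<rightarrow>\<^sub>M borel" if "r \<in> X" for r
    using measurable_component_singleton [OF that, of "\<lambda>_. gauss"]
    by (simp cong: measurable_cong_sets)
  show ?thesis unfolding rotate_def
    by (rule measurable_fun_upd [OF X(2)], rule measurable_fun_upd [OF X(1)])
      (use assms in \<open>simp_all cong: measurable_cong_sets\<close>)
qed

definition gauss_preserving :: "'k set \<Rightarrow> (('k \<Rightarrow> real) \<Rightarrow> 'k \<Rightarrow> real) \<Rightarrow> bool" where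
  "gauss_preserving X T \<longleftrightarrow> T \<in> PiM X (\<lambda>_. gauss) \<rightarrow>\<^sub>M PiM X (\<lambda>_. gauss) \<and>
     distr (PiM X (\<lambda>_. gauss)) (PiM X (\<lambda>_. gauss)) T = PiM X (\<lambda>_. gauss)"

lemma gauss_preserving_id: "gauss_preserving X (\<lambda>x. x)"
  by (simp add: gauss_preserving_def distr_id2)

lemma gauss_preserving_comp:
  assumes "gauss_preserving X S" "gauss_preserving X T"
  shows "gauss_preserving X (S \<circ> T)"
  using assms unfolding gauss_preserving_def
  by (metis distr_distr measurable_comp)

lemma measure_vimage_gauss_preserving:
  assumes "gauss_preserving X T" "A \<in> sets (PiM X (\<lambda>_. gauss))"
  shows "measure (PiM X (\<lambda>_. gauss)) {x \<in> space (PiM X (\<lambda>_. gauss)). T x \<in> A}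
       = measure (PiM X (\<lambda>_. gauss)) A"
proof -
  have T: "T \<in> PiM X (\<lambda>_. gauss) \<rightarrow>\<^sub>M PiM X (\<lambda>_. gauss)"
    and d: "distr (PiM X (\<lambda>_. gauss)) (PiM X (\<lambda>_. gauss)) T = PiM X (\<lambda>_. gauss)"
    using assms(1) by (auto simp: gauss_preserving_def)
  have "measure (PiM X (\<lambda>_. gauss)) A
      = measure (distr (PiM X (\<lambda>_. gauss)) (PiM X (\<lambda>_. gauss)) T) A" by (simp add: d)
  also have "\<dots> = measure (PiM X (\<lambda>_. gauss)) (T -` A \<inter> space (PiM X (\<lambda>_. gauss)))"
    by (rule measure_distr [OF T assms(2)])
  also have "T -` A \<inter> space (PiM X (\<lambda>_. gauss)) = {x \<in> space (PiM X (\<lambda>_. gauss)). T x \<in> A}"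
    by auto
  finally show ?thesis by simp
qed

lemma gauss_preserving_rotate:
  fixes X :: "'k set"
  assumes X: "finite X" "p \<in> X" "q \<in> X" "p \<noteq> q" and cs: "c\<^sup>2 + s\<^sup>2 = 1" and c: "c \<noteq> 0"
  shows "gauss_preserving X (rotate c s p q)"
  unfolding gauss_preserving_def
proof
  let ?G = "\<lambda>X::'k set. PiM X (\<lambda>_. gauss)"
  show T: "rotate c s p q \<in> ?G X \<rightarrow>\<^sub>M ?G X" using X by measurable
  define Y where "Y = X - {p, q}"
  have Y: "finite Y" "q \<notin> Y" "finite (insert q Y)" "p \<notin> insert q Y" "X = insert p (insert q Y)"
    using X by (auto simp: Y_def)
  have integral: "(\<integral>\<^sup>+x. F x \<partial>?G X)
      = (\<integral>\<^sup>+z. \<integral>\<^sup>+v. \<integral>\<^sup>+u. F (z(q := v, p := u)) \<partial>gauss \<partial>gauss \<partial>?G Y)"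
    if F: "F \<in> borel_measurable (?G X)" for F
  proof -
    have [measurable]: "F \<in> borel_measurable (?G (insert p (insert q Y)))"
      using F Y(5) by simp
    show ?thesis
      unfolding Y(5)
      by (subst gauss_prod.product_nn_integral_insert [OF Y(3,4)], simp,
          subst gauss_prod.product_nn_integral_insert [OF Y(1,2)]) measurable
  qed
  show "distr (?G X) (?G X) (rotate c s p q) = ?G X"
  proof (rule measure_eqI)
    fix A assume "A \<in> sets (distr (?G X) (?G X) (rotate c s p q))"
    then have A: "A \<in> sets (?G X)" by simp
    have m1: "indicator A \<in> borel_measurable (?G X)" using A by simp
    have "emeasure (distr (?G X) (?G X) (rotate c s p q)) A
        = (\<integral>\<^sup>+x. indicator A x \<partial>distr (?G X) (?G X) (rotate c s p q))" using A by simp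
    also have "\<dots> = (\<integral>\<^sup>+x. indicator A (rotate c s p q x) \<partial>?G X)"
      by (rule nn_integral_distr [OF T]) (use A in simp)
    also have "\<dots> = (\<integral>\<^sup>+z. \<integral>\<^sup>+v. \<integral>\<^sup>+u. indicator A (rotate c s p q (z(q := v, p := u))) \<partial>gauss \<partial>gauss \<partial>?G Y)"
      by (rule integral) (use T m1 in measurable)
    also have "\<dots> = (\<integral>\<^sup>+z. \<integral>\<^sup>+v. \<integral>\<^sup>+u. indicator A (z(q := v, p := u)) \<partial>gauss \<partial>gauss \<partial>?G Y)"
    proof (rule nn_integral_cong)
      fix z assume z: "z \<in> space (?G Y)"
      have m: "(\<lambda>(u, v). z(q := v, p := u)) \<in> borel \<Otimes>\<^sub>M borel \<rightarrow>\<^sub>M ?G (insert p (insert q Y))"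
        unfolding split_beta'
        by (rule measurable_fun_upd [where J = "insert q Y"], simp,
            rule measurable_fun_upd [where J = Y]) (use z in \<open>simp_all cong: measurable_cong_sets\<close>)
      have [measurable]: "(\<lambda>(u, v). indicator A (z(q := v, p := u)) :: ennreal) \<in> borel_measurable borel"
        using measurable_compose [OF m [folded Y(5)] m1]
        by (simp add: split_beta' borel_prod)
      have rot: "rotate c s p q (z(q := v, p := u)) = z(q := - s * u + c * v, p := c * u + s * v)" for u v
        using X(4) by (auto simp: rotate_def fun_eq_iff)
      show "(\<integral>\<^sup>+v. \<integral>\<^sup>+u. indicator A (rotate c s p q (z(q := v, p := u))) \<partial>gauss \<partial>gauss)
          = (\<integral>\<^sup>+v. \<integral>\<^sup>+u. indicator A (z(q := v, p := u)) \<partial>gauss \<partial>gauss)"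
        using nn_integral_gauss_rotate [OF cs c, of "\<lambda>(u, v). indicator A (z(q := v, p := u))"]
        by (simp add: rot)
    qed
    also have "\<dots> = (\<integral>\<^sup>+x. indicator A x \<partial>?G X)" by (rule integral [OF m1, symmetric])
    also have "\<dots> = emeasure (?G X) A" using A by simp
    finally show "emeasure (distr (?G X) (?G X) (rotate c s p q)) A = emeasure (?G X) A" .
  qed simp
qed

text \<open>Disjoint pairs can be rotated one after the other without disturbing each other. Rotating
  rows \<open>i\<close> and \<open>j\<close> of a matrix is of this kind, with the pairs \<open>(i, a), (j, a)\<close>.\<close>

lemma gauss_preserving_rotate_pairs:
  fixes p q :: "'b \<Rightarrow> 'k"
  assumes X: "finite X" and A: "finite A"
    and pq: "p ` A \<subseteq> X" "q ` A \<subseteq> X" "inj_on p A" "inj_on q A" "p ` A \<inter> q ` A = {}"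
    and cs: "c\<^sup>2 + s\<^sup>2 = 1" "c \<noteq> 0"
  obtains T where "gauss_preserving X T"
    "\<And>x a. a \<in> A \<Longrightarrow> T x (p a) = c * x (p a) + s * x (q a)"
    "\<And>x a. a \<in> A \<Longrightarrow> T x (q a) = - s * x (p a) + c * x (q a)"
    "\<And>x z. z \<notin> p ` A \<union> q ` A \<Longrightarrow> T x z = x z"
proof -
  have "\<exists>T. gauss_preserving X T \<and>
      (\<forall>x. \<forall>a\<in>A. T x (p a) = c * x (p a) + s * x (q a) \<and> T x (q a) = - s * x (p a) + c * x (q a)) \<and>
      (\<forall>x z. z \<notin> p ` A \<union> q ` A \<longrightarrow> T x z = x z)"
    using A pq
  proof (induction A)
    case empty
    show ?case by (rule exI [of _ "\<lambda>x. x"]) (simp add: gauss_preserving_id)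
  next
    case (insert b A)
    then obtain T where T: "gauss_preserving X T"
      "\<And>x a. a \<in> A \<Longrightarrow> T x (p a) = c * x (p a) + s * x (q a)"
      "\<And>x a. a \<in> A \<Longrightarrow> T x (q a) = - s * x (p a) + c * x (q a)"
      "\<And>x z. z \<notin> p ` A \<union> q ` A \<Longrightarrow> T x z = x z"
      by (auto simp: inj_on_insert) 
    have new: "p b \<notin> p ` A" "q b \<notin> q ` A" "p b \<notin> q ` A" "q b \<notin> p ` A" "p b \<noteq> q b"
      using insert.prems insert.hyps by (auto simp: inj_on_def)
    have R: "gauss_preserving X (rotate c s (p b) (q b))"
      by (rule gauss_preserving_rotate) (use insert.prems X cs new in auto)
    show ?case
    proof (intro exI conjI allI ballI impI)
      show "gauss_preserving X (rotate c s (p b) (q b) \<circ> T)"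
        by (rule gauss_preserving_comp [OF R T(1)])
    next
      fix x a assume a: "a \<in> insert b A"
      have "a = b \<or> a \<in> A \<and> p a \<noteq> p b \<and> q a \<noteq> q b \<and> p a \<noteq> q b \<and> q a \<noteq> p b"
        using a new by (metis imageI insertE)
      then show "(rotate c s (p b) (q b) \<circ> T) x (p a) = c * x (p a) + s * x (q a)"
        "(rotate c s (p b) (q b) \<circ> T) x (q a) = - s * x (p a) + c * x (q a)"
        using new T(2,3,4) by (auto simp: rotate_def)
    next
      fix x z assume "z \<notin> p ` insert b A \<union> q ` insert b A"
      then show "(rotate c s (p b) (q b) \<circ> T) x z = x z"
        using T(4) by (auto simp: rotate_def)
    qed
  qed
  then show thesis using that by blast
qed

section \<open>Quadratic forms and conjugation by rotations\<close>

abbreviation gauss_matrix :: "'k set \<Rightarrow> ('k \<times> 'k \<Rightarrow> real) measure" where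
  "gauss_matrix I \<equiv> PiM (I \<times> I) (\<lambda>_. gauss)"

definition inner_on :: "'k set \<Rightarrow> ('k \<Rightarrow> real) \<Rightarrow> ('k \<Rightarrow> real) \<Rightarrow> real" where
  "inner_on I x y = (\<Sum>i\<in>I. x i * y i)"

definition quad_form :: "'k set \<Rightarrow> ('k \<times> 'k \<Rightarrow> real) \<Rightarrow> ('k \<Rightarrow> real) \<Rightarrow> real" where
  "quad_form I J m = (\<Sum>i\<in>I. \<Sum>j\<in>I. J (i, j) * m i * m j)"

text \<open>The linear form in the remaining coordinates that multiplies \<open>m i\<close> when the quadratic form is
  expanded in \<open>m i\<close>; see \<open>quad_form_remove\<close>.\<close>

definition cross_part :: "'k \<Rightarrow> ('k \<times> 'k \<Rightarrow> real) \<Rightarrow> 'k \<Rightarrow> real" where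
  "cross_part i J a = J (i, a) + J (a, i)"

lemma inner_on_self_nonneg: "0 \<le> inner_on I x x"
  by (simp add: inner_on_def sum_nonneg)

lemma inner_on_scale:
  "inner_on I (\<lambda>i. c * x i) y = c * inner_on I x y" "inner_on I x (\<lambda>i. c * y i) = c * inner_on I x y"
  by (simp_all add: inner_on_def sum_distrib_left mult_ac)

lemma inner_on_div: "inner_on I (\<lambda>i. x i / c) y = inner_on I x y / c"
  by (simp add: inner_on_def sum_divide_distrib)

lemma inner_on_div_self: "inner_on I (\<lambda>i. x i / c) (\<lambda>i. x i / c) = inner_on I x x / c\<^sup>2"
  by (simp add: inner_on_def sum_divide_distrib power2_eq_square)

lemma inner_on_Cauchy_Schwarz: "(inner_on I x y)\<^sup>2 \<le> inner_on I x x * inner_on I y y"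
  using Cauchy_Schwarz_ineq_sum [of x y I] by (simp add: inner_on_def power2_eq_square)

lemma inner_on_cong: "(\<And>i. i \<in> I \<Longrightarrow> x i = x' i) \<Longrightarrow> (\<And>i. i \<in> I \<Longrightarrow> y i = y' i) \<Longrightarrow>
    inner_on I x y = inner_on I x' y'"
  by (simp add: inner_on_def)

lemma quad_form_scale: "quad_form I J (\<lambda>i. c * m i) = c\<^sup>2 * quad_form I J m"
  by (simp add: quad_form_def sum_distrib_left power2_eq_square mult_ac)

lemma quad_form_inner: "quad_form I J m = inner_on I (\<lambda>i. inner_on I (\<lambda>j. J (i, j)) m) m"
  by (simp add: quad_form_def inner_on_def sum_distrib_left sum_distrib_right mult_ac)

lemma quad_form_inner': "quad_form I J m = inner_on I (\<lambda>j. inner_on I (\<lambda>i. J (i, j)) m) m"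
  unfolding quad_form_def inner_on_def
  by (subst sum.swap) (simp add: sum_distrib_left sum_distrib_right mult_ac)

lemma inner_on_remove:
  assumes "finite I" "i \<in> I"
  shows "inner_on I x y = x i * y i + inner_on (I - {i}) x y"
  using assms by (simp add: inner_on_def sum.remove)

lemma quad_form_remove:
  assumes "finite I" "i \<in> I"
  shows "quad_form I J m
       = J (i, i) * (m i)\<^sup>2 + m i * inner_on (I - {i}) (cross_part i J) m + quad_form (I - {i}) J m"
  using assms
  by (simp add: quad_form_def inner_on_def cross_part_def sum.remove [of I i] sum.distrib
      sum_distrib_left algebra_simps power2_eq_square)

lemma inner_on_rotate:
  assumes "finite I" "i \<in> I" "j \<in> I" "i \<noteq> j" "c\<^sup>2 + s\<^sup>2 = 1"
  shows "inner_on I (rotate c s i j x) (rotate c s i j y) = inner_on I x y"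
proof -
  have j: "j \<in> I - {i}" "finite (I - {i})" using assms by auto
  have "inner_on (I - {i} - {j}) (rotate c s i j x) (rotate c s i j y) = inner_on (I - {i} - {j}) x y"
    by (rule inner_on_cong) (auto simp: rotate_def)
  moreover have "(c * x i + s * x j) * (c * y i + s * y j) + (- s * x i + c * x j) * (- s * y i + c * y j)
      = (c\<^sup>2 + s\<^sup>2) * (x i * y i + x j * y j)"
    by (simp add: algebra_simps power2_eq_square)
  ultimately show ?thesis
    unfolding inner_on_remove [OF assms(1,2)] inner_on_remove [OF j(2,1)]
    using assms(4,5) by (simp add: rotate_def)
qed

lemma rotate_surj:
  assumes "i \<noteq> j" "c\<^sup>2 + s\<^sup>2 = 1"
  obtains m' where "m = rotate c s i j m'"
proof
  have "c * (c * a - s * b) + s * (s * a + c * b) = a" "- s * (c * a - s * b) + c * (s * a + c * b) = b" for a b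
  proof -
    have "c * (c * a - s * b) + s * (s * a + c * b) = (c\<^sup>2 + s\<^sup>2) * a"
      "- s * (c * a - s * b) + c * (s * a + c * b) = (c\<^sup>2 + s\<^sup>2) * b"
      by (simp_all add: algebra_simps power2_eq_square)
    then show "c * (c * a - s * b) + s * (s * a + c * b) = a" "- s * (c * a - s * b) + c * (s * a + c * b) = b"
      using assms(2) by simp_all
  qed
  note rot = this
  show "m = rotate c s i j (m(i := c * m i - s * m j, j := s * m i + c * m j))"
    using assms(1) rot [of "m i" "m j"] by (auto simp: rotate_def fun_eq_iff)
qed

text \<open>Conjugation \<open>J \<mapsto> R J R\<^sup>T\<close> by a plane rotation \<open>R\<close> is a rotation of two rows followed by one of two
  columns. All that is used of it later is its effect on the quadratic form.\<close>

lemma gauss_preserving_conjugation: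
  fixes I :: "'k set"
  assumes I: "finite I" "i \<in> I" "j \<in> I" "i \<noteq> j" and cs: "c\<^sup>2 + s\<^sup>2 = 1" "c \<noteq> 0"
  obtains T where "gauss_preserving (I \<times> I) T"
    "\<And>J m. quad_form I (T J) (rotate c s i j m) = quad_form I J m"
proof -
  obtain R where R: "gauss_preserving (I \<times> I) R"
    "\<And>x a. a \<in> I \<Longrightarrow> R x (i, a) = c * x (i, a) + s * x (j, a)"
    "\<And>x a. a \<in> I \<Longrightarrow> R x (j, a) = - s * x (i, a) + c * x (j, a)"
    "\<And>x z. z \<notin> Pair i ` I \<union> Pair j ` I \<Longrightarrow> R x z = x z"
    by (rule gauss_preserving_rotate_pairs [of "I \<times> I" I "Pair i" "Pair j" c s])
      (use I cs in \<open>auto simp: inj_on_def\<close>)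
  obtain C where C: "gauss_preserving (I \<times> I) C"
    "\<And>x a. a \<in> I \<Longrightarrow> C x (a, i) = c * x (a, i) + s * x (a, j)"
    "\<And>x a. a \<in> I \<Longrightarrow> C x (a, j) = - s * x (a, i) + c * x (a, j)"
    "\<And>x z. z \<notin> (\<lambda>a. (a, i)) ` I \<union> (\<lambda>a. (a, j)) ` I \<Longrightarrow> C x z = x z"
    by (rule gauss_preserving_rotate_pairs [of "I \<times> I" I "\<lambda>a. (a, i)" "\<lambda>a. (a, j)" c s])
      (use I cs in \<open>auto simp: inj_on_def\<close>)
  have Rrow: "R J (x, y) = rotate c s i j (\<lambda>x. J (x, y)) x" if "y \<in> I" for J x y
    using R(2,3) [OF that, of J] R(4) [of "(x, y)" J] I(4) by (auto simp: rotate_def)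
  have Ccol: "C J (x, y) = rotate c s i j (\<lambda>y. J (x, y)) y" if "x \<in> I" for J x y
    using C(2,3) [OF that, of J] C(4) [of "(x, y)" J] I(4) by (auto simp: rotate_def)
  show thesis
  proof
    show "gauss_preserving (I \<times> I) (C \<circ> R)" by (rule gauss_preserving_comp [OF C(1) R(1)])
  next
    fix J m
    let ?m = "rotate c s i j m"
    have "quad_form I ((C \<circ> R) J) ?m = inner_on I (\<lambda>x. inner_on I (rotate c s i j (\<lambda>y. R J (x, y))) ?m) ?m"
      unfolding quad_form_inner by (intro inner_on_cong) (simp_all add: Ccol cong: inner_on_cong)
    also have "\<dots> = inner_on I (\<lambda>x. inner_on I (\<lambda>y. R J (x, y)) m) ?m"
      by (simp add: inner_on_rotate [OF I cs(1)])
    also have "\<dots> = inner_on I (\<lambda>y. inner_on I (\<lambda>x. R J (x, y)) ?m) m"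
      unfolding inner_on_def sum_distrib_right by (subst sum.swap) (simp add: mult_ac)
    also have "\<dots> = inner_on I (\<lambda>y. inner_on I (rotate c s i j (\<lambda>x. J (x, y))) ?m) m"
      by (intro inner_on_cong) (simp_all add: Rrow cong: inner_on_cong)
    also have "\<dots> = quad_form I J m"
      unfolding quad_form_inner' by (simp add: inner_on_rotate [OF I cs(1)])
    finally show "quad_form I ((C \<circ> R) J) ?m = quad_form I J m" .
  qed
qed


text \<open>An event that is defined in terms of the quadratic form of \<open>J\<close> and a vector \<open>u\<close>, in a way that
  does not refer to the coordinate system, has a probability that depends on the length of \<open>u\<close> only:
  each plane rotation can annihilate one coordinate of \<open>u\<close>, until a multiple of a basis vector is left.\<close>

lemma measure_le_by_axis_reduction:
  fixes Bad :: "('k \<Rightarrow> real) \<Rightarrow> ('k \<times> 'k \<Rightarrow> real) \<Rightarrow> bool"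
  assumes I: "finite I" "I \<noteq> {}"
    and meas: "\<And>u. {J \<in> space (gauss_matrix I). Bad u J} \<in> sets (gauss_matrix I)"
    and inv: "\<And>i j c s u J J'. i \<in> I \<Longrightarrow> j \<in> I \<Longrightarrow> i \<noteq> j \<Longrightarrow> c\<^sup>2 + s\<^sup>2 = 1 \<Longrightarrow>
        (\<And>m. quad_form I J' (rotate c s i j m) = quad_form I J m) \<Longrightarrow>
        Bad u J \<Longrightarrow> Bad (rotate c s i j u) J'"
    and axis: "\<And>i v. i \<in> I \<Longrightarrow> \<forall>j\<in>I - {i}. v j = 0 \<Longrightarrow> inner_on I v v = inner_on I u u \<Longrightarrow>
        measure (gauss_matrix I) {J \<in> space (gauss_matrix I). Bad v J} \<le> p"
  shows "measure (gauss_matrix I) {J \<in> space (gauss_matrix I). Bad u J} \<le> p"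
proof -
  interpret prob_space "gauss_matrix I" by (rule prob_space_gauss_PiM)
  have "measure (gauss_matrix I) {J \<in> space (gauss_matrix I). Bad v J} \<le> p"
    if "inner_on I v v = inner_on I u u" for v
    using that
  proof (induction "card {i \<in> I. v i \<noteq> 0}" arbitrary: v rule: less_induct)
    case less
    show ?case
    proof (cases "\<exists>i\<in>I. \<forall>j\<in>I - {i}. v j = 0")
      case True
      then show ?thesis using axis less.prems by blast
    next
      case False
      obtain i where i: "i \<in> I" "v i \<noteq> 0"
        using False I(2) by (metis DiffD1 ex_in_conv)
      obtain j where j: "j \<in> I" "j \<noteq> i" "v j \<noteq> 0" using False i(1) by auto
      define r where "r = sqrt ((v i)\<^sup>2 + (v j)\<^sup>2)"
      have pos: "(v i)\<^sup>2 + (v j)\<^sup>2 > 0" using i by (simp add: sum_power2_gt_zero_iff)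
      have r: "r > 0" "r\<^sup>2 = (v i)\<^sup>2 + (v j)\<^sup>2" using pos by (simp_all add: r_def)
      \<comment> \<open>The rotation that annihilates \<open>v j\<close>; its cosine is nonzero because \<open>v i\<close> is.\<close>
      define c where "c = v i / r"
      define s where "s = v j / r"
      have cs: "c\<^sup>2 + s\<^sup>2 = 1" "c \<noteq> 0"
        using r i pos by (simp_all add: c_def s_def power_divide add_divide_distrib [symmetric])
      obtain T where T: "gauss_preserving (I \<times> I) T"
        "\<And>J m. quad_form I (T J) (rotate c s i j m) = quad_form I J m"
        using gauss_preserving_conjugation [of I i j c s] I i j cs by metis
      define w where "w = rotate c s i j v"
      have zero: "w j = 0" using r j by (simp add: w_def rotate_def c_def s_def)
      have "{k \<in> I. w k \<noteq> 0} \<subseteq> {k \<in> I. v k \<noteq> 0} - {j}"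
        using zero i by (auto simp: w_def rotate_def split: if_splits)
      then have "{k \<in> I. w k \<noteq> 0} \<subset> {k \<in> I. v k \<noteq> 0}" using j by auto
      then have "card {k \<in> I. w k \<noteq> 0} < card {k \<in> I. v k \<noteq> 0}"
        using I(1) by (intro psubset_card_mono) auto
      moreover have "inner_on I w w = inner_on I u u"
        using less.prems inner_on_rotate [OF I(1) i(1) j(1) j(2)[symmetric] cs(1)] by (simp add: w_def)
      ultimately have "measure (gauss_matrix I) {J \<in> space (gauss_matrix I). Bad w J} \<le> p"
        by (rule less.hyps)
      moreover have "measure (gauss_matrix I) {J \<in> space (gauss_matrix I). Bad v J}
          \<le> measure (gauss_matrix I) {J \<in> space (gauss_matrix I). T J \<in> {J \<in> space (gauss_matrix I). Bad w J}}"
      proof (rule finite_measure_mono)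
        have Tm: "T \<in> gauss_matrix I \<rightarrow>\<^sub>M gauss_matrix I"
          using T(1) by (simp add: gauss_preserving_def)
        show "{J \<in> space (gauss_matrix I). Bad v J}
            \<subseteq> {J \<in> space (gauss_matrix I). T J \<in> {J \<in> space (gauss_matrix I). Bad w J}}"
          using measurable_space [OF Tm] inv [OF i(1) j(1) j(2)[symmetric] cs(1) T(2)] by (auto simp: w_def)
        show "{J \<in> space (gauss_matrix I). T J \<in> {J \<in> space (gauss_matrix I). Bad w J}} \<in> sets (gauss_matrix I)"
          using measurable_sets [OF Tm meas [of w]] by (simp add: vimage_def Int_def conj_commute)
      qed
      ultimately show ?thesis
        using measure_vimage_gauss_preserving [OF T(1) meas [of w]] by simp
    qed
  qed
  then show ?thesis by simp
qed


section \<open>Tails of sums of squares\<close>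

text \<open>The factor \<open>exp (t x\<^sup>2)\<close> turns the standard Gaussian density into a multiple of the Gaussian
  density of variance \<open>1 / (1 - 2 t)\<close>.\<close>

lemma nn_integral_gauss_exp_square:
  assumes t: "t < 1 / 2"
  shows "(\<integral>\<^sup>+x. ennreal (exp (t * x\<^sup>2)) \<partial>gauss) = ennreal (1 / sqrt (1 - 2 * t))"
proof -
  define \<sigma> where "\<sigma> = 1 / sqrt (1 - 2 * t)"
  have \<sigma>: "\<sigma> > 0" "\<sigma>\<^sup>2 = 1 / (1 - 2 * t)" using t by (simp_all add: \<sigma>_def power_divide)
  have eq: "std_normal_density x * exp (t * x\<^sup>2) = \<sigma> * normal_density 0 \<sigma> x" for x
  proof -
    have "- x\<^sup>2 / 2 + t * x\<^sup>2 = - (x - 0)\<^sup>2 / (2 * \<sigma>\<^sup>2)"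
      unfolding \<sigma>(2) using t by (simp add: field_simps)
    moreover have "sqrt (2 * pi * \<sigma>\<^sup>2) = sqrt (2 * pi) * \<sigma>"
      using \<sigma>(1) by (simp add: real_sqrt_mult)
    ultimately show ?thesis
      using \<sigma>(1) by (simp add: normal_density_def mult_exp_exp)
  qed
  have "(\<integral>\<^sup>+x. ennreal (exp (t * x\<^sup>2)) \<partial>gauss)
      = (\<integral>\<^sup>+x. ennreal (std_normal_density x) * ennreal (exp (t * x\<^sup>2)) \<partial>lborel)"
    unfolding gauss_def by (rule nn_integral_density) simp_all
  also have "\<dots> = (\<integral>\<^sup>+x. ennreal \<sigma> * ennreal (normal_density 0 \<sigma> x) \<partial>lborel)"
    using \<sigma>(1) by (intro nn_integral_cong) (simp add: ennreal_mult [symmetric] eq)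
  also have "\<dots> = ennreal \<sigma> * (\<integral>\<^sup>+x. ennreal (normal_density 0 \<sigma> x) \<partial>lborel)"
    by (rule nn_integral_cmult) simp
  also have "(\<integral>\<^sup>+x. ennreal (normal_density 0 \<sigma> x) \<partial>lborel) = 1"
    using \<sigma>(1) integral_normal_density [of \<sigma> 0] integrable_normal_density [of \<sigma> 0]
    by (subst nn_integral_eq_integral) simp_all
  finally show ?thesis by (simp add: \<sigma>_def)
qed

lemma measurable_gauss_component:
  "z \<in> X \<Longrightarrow> (\<lambda>x. x z) \<in> borel_measurable (PiM X (\<lambda>_. gauss))"
  using measurable_component_singleton [of z X "\<lambda>_. gauss"] by (simp cong: measurable_cong_sets)

text \<open>Markov's inequality for the exponential moment. Since \<open>t\<close> may have either sign, this covers
  both tails.\<close>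

lemma gauss_square_sum_tail:
  assumes X: "finite X" "Z \<subseteq> X" and t: "t < 1 / 2"
  shows "measure (PiM X (\<lambda>_. gauss)) {x \<in> space (PiM X (\<lambda>_. gauss)). r \<le> t * (\<Sum>z\<in>Z. (x z)\<^sup>2)}
       \<le> (1 / sqrt (1 - 2 * t)) ^ card Z * exp (- r)"
proof -
  let ?G = "PiM X (\<lambda>_. gauss)"
  let ?S = "{x \<in> space ?G. r \<le> t * (\<Sum>z\<in>Z. (x z)\<^sup>2)}"
  interpret prob_space ?G by (rule prob_space_gauss_PiM)
  have fin: "finite Z" using X by (rule finite_subset [rotated])
  have [measurable]: "(\<lambda>x. \<Sum>z\<in>Z. (x z)\<^sup>2) \<in> borel_measurable ?G"
    by (intro borel_measurable_sum borel_measurable_power measurable_gauss_component) (use X in auto)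
  have S: "?S \<in> sets ?G" by measurable
  define f :: "'a \<Rightarrow> real \<Rightarrow> ennreal"
    where "f = (\<lambda>z. if z \<in> Z then (\<lambda>y. ennreal (exp (t * y\<^sup>2))) else (\<lambda>_. 1))"
  have f: "f z \<in> borel_measurable gauss" for z
    by (cases "z \<in> Z") (simp_all add: f_def cong: measurable_cong_sets)
  have prod: "(\<Prod>z\<in>X. f z (x z)) = ennreal (exp (t * (\<Sum>z\<in>Z. (x z)\<^sup>2)))" for x
  proof -
    have "(\<Prod>z\<in>X. f z (x z)) = (\<Prod>z\<in>Z. ennreal (exp (t * (x z)\<^sup>2)))"
      using X by (intro prod.mono_neutral_cong_right) (auto simp: f_def)
    also have "\<dots> = ennreal (\<Prod>z\<in>Z. exp (t * (x z)\<^sup>2))" by (simp add: prod_ennreal)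
    finally show ?thesis by (simp add: exp_sum [OF fin] sum_distrib_left)
  qed
  have "emeasure ?G ?S = (\<integral>\<^sup>+x. indicator ?S x \<partial>?G)" using S by simp
  also have "\<dots> \<le> (\<integral>\<^sup>+x. ennreal (exp (- r)) * (\<Prod>z\<in>X. f z (x z)) \<partial>?G)"
    unfolding prod
    by (intro nn_integral_mono)
      (auto simp: indicator_def ennreal_mult [symmetric] mult_exp_exp simp flip: ennreal_1)
  also have "\<dots> = ennreal (exp (- r)) * (\<integral>\<^sup>+x. (\<Prod>z\<in>X. f z (x z)) \<partial>?G)"
    unfolding prod by (rule nn_integral_cmult) measurable
  also have "(\<integral>\<^sup>+x. (\<Prod>z\<in>X. f z (x z)) \<partial>?G) = (\<Prod>z\<in>X. integral\<^sup>N gauss (f z))"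
    by (rule gauss_prod.product_nn_integral_prod [OF X(1) f])
  also have "\<dots> = (\<Prod>z\<in>Z. ennreal (1 / sqrt (1 - 2 * t)))"
    using X nn_integral_gauss_exp_square [OF t] gauss.emeasure_space_1
    by (intro prod.mono_neutral_cong_right) (auto simp: f_def)
  also have "\<dots> = ennreal ((1 / sqrt (1 - 2 * t)) ^ card Z)"
    using t by (simp add: ennreal_power)
  finally have "emeasure ?G ?S \<le> ennreal ((1 / sqrt (1 - 2 * t)) ^ card Z * exp (- r))"
    using t by (simp add: ennreal_mult mult.commute)
  then show ?thesis
    using t by (simp add: emeasure_eq_measure)
qed

text \<open>Rotating each pair \<open>J (i, a), J (a, i)\<close> by 45 degrees makes \<open>(J (i, a) + J (a, i)) / sqrt 2\<close> a
  single coordinate, so the squared length of the cross part is distributed as \<open>2\<close> times a sum of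
  squares of independent standard Gaussians.\<close>

lemma cross_part_tail:
  assumes I: "finite I" "i \<in> I" and t: "t < 1 / 2"
  shows "measure (gauss_matrix I) {J \<in> space (gauss_matrix I).
           2 * r \<le> t * inner_on (I - {i}) (cross_part i J) (cross_part i J)}
       \<le> (1 / sqrt (1 - 2 * t)) ^ (card I - 1) * exp (- r)"
proof -
  let ?G = "gauss_matrix I" and ?c = "1 / sqrt 2 :: real"
  have cs: "?c\<^sup>2 + ?c\<^sup>2 = 1" "?c \<noteq> 0" by (simp_all add: power_divide)
  obtain T where T: "gauss_preserving (I \<times> I) T"
    "\<And>x a. a \<in> I - {i} \<Longrightarrow> T x (i, a) = ?c * x (i, a) + ?c * x (a, i)"
    by (rule gauss_preserving_rotate_pairs [of "I \<times> I" "I - {i}" "Pair i" "\<lambda>a. (a, i)" ?c ?c])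
      (use I cs in \<open>auto simp: inj_on_def\<close>)
  have sq: "2 * (T J (i, a))\<^sup>2 = cross_part i J a * cross_part i J a" if "a \<in> I - {i}" for J a
  proof -
    have "T J (i, a) = cross_part i J a / sqrt 2"
      using T(2) [OF that, of J] by (simp add: cross_part_def add_divide_distrib)
    then show ?thesis by (simp add: power_divide power2_eq_square)
  qed
  define Z where "Z = Pair i ` (I - {i})"
  have Z: "Z \<subseteq> I \<times> I" "card Z = card I - 1"
    using I by (auto simp: Z_def card_image inj_on_def)
  have sum: "inner_on (I - {i}) (cross_part i J) (cross_part i J) = 2 * (\<Sum>z\<in>Z. (T J z)\<^sup>2)" for J
    unfolding Z_def inner_on_def
    by (subst sum.reindex) (auto simp: inj_on_def sum_distrib_left sq intro!: sum.cong)
  let ?S = "{x \<in> space ?G. r \<le> t * (\<Sum>z\<in>Z. (x z)\<^sup>2)}"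
  have [measurable]: "(\<lambda>x. \<Sum>z\<in>Z. (x z)\<^sup>2) \<in> borel_measurable ?G"
    by (intro borel_measurable_sum borel_measurable_power measurable_gauss_component) (use Z(1) in auto)
  have S: "?S \<in> sets ?G" by measurable
  have "T \<in> ?G \<rightarrow>\<^sub>M ?G" using T(1) by (simp add: gauss_preserving_def)
  then have "{J \<in> space ?G. 2 * r \<le> t * inner_on (I - {i}) (cross_part i J) (cross_part i J)}
      = {J \<in> space ?G. T J \<in> ?S}"
    by (auto simp: sum dest: measurable_space)
  then show ?thesis
    using measure_vimage_gauss_preserving [OF T(1) S] gauss_square_sum_tail [OF _ Z(1) t, of r] I Z(2)
    by simp
qed

section \<open>Peeling off one coordinate\<close>

text \<open>The cross part of \<open>i\<close> is made of entries in row or column \<open>i\<close>, hence is independent of the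
  submatrix on \<open>I - {i}\<close>. By Fubini it can be frozen, and a bound for the smaller matrix that is uniform
  in the deterministic vector passes to the larger one, at the cost of an exceptional event.\<close>

lemma measure_le_by_peeling:
  fixes I :: "'k set"
  assumes I: "finite I" "i \<in> I"
    and Bad: "Bad \<in> sets (gauss_matrix I)" and Exc: "Exc \<in> sets (gauss_matrix I)"
    and d: "measure (gauss_matrix I) Exc \<le> d" and p: "0 \<le> p"
    and step: "\<And>J. J \<in> Bad \<Longrightarrow> J \<notin> Exc \<Longrightarrow>
        restrict J ((I - {i}) \<times> (I - {i})) \<in> Bad' (cross_part i J) \<and>
        Bad' (cross_part i J) \<in> sets (gauss_matrix (I - {i})) \<and>
        measure (gauss_matrix (I - {i})) (Bad' (cross_part i J)) \<le> p"
  shows "measure (gauss_matrix I) Bad \<le> d + p"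
proof -
  let ?A = "(I - {i}) \<times> (I - {i})"
  let ?B = "I \<times> I - ?A"
  let ?merge = "merge (I \<times> I - (I - {i}) \<times> (I - {i})) ((I - {i}) \<times> (I - {i}))"
  let ?GA = "PiM ?A (\<lambda>_. gauss)" and ?GB = "PiM ?B (\<lambda>_. gauss)"
  interpret prob_space "gauss_matrix I" by (rule prob_space_gauss_PiM)
  interpret A: prob_space ?GA by (rule prob_space_gauss_PiM)
  interpret B: prob_space ?GB by (rule prob_space_gauss_PiM)
  have AB: "?B \<union> ?A = I \<times> I" "?B \<inter> ?A = {}" "finite ?B" "finite ?A" using I by auto
  define S where "S = Bad - Exc"
  have S: "S \<in> sets (gauss_matrix I)" using Bad Exc by (simp add: S_def)
  have section_le: "(\<integral>\<^sup>+x. indicator S (?merge (y, x)) \<partial>?GA) \<le> ennreal p"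
    if y: "y \<in> space ?GB" for y
  proof (cases "\<exists>x\<in>space ?GA. ?merge (y, x) \<in> S")
    case True
    then obtain x\<^sub>0 where x0: "x\<^sub>0 \<in> space ?GA" "?merge (y, x\<^sub>0) \<in> S" by blast
    define v where "v = cross_part i (?merge (y, x\<^sub>0))"
    \<comment> \<open>Entries of the submatrix do not occur, since \<open>i\<close> does not index it.\<close>
    have v: "cross_part i (?merge (y, x)) = v" for x
      by (auto simp: v_def cross_part_def merge_def fun_eq_iff)
    have sets: "Bad' v \<in> sets ?GA" "measure ?GA (Bad' v) \<le> p"
      using step x0(2) by (auto simp: S_def v_def)
    have "x \<in> Bad' v" if x: "x \<in> space ?GA" "?merge (y, x) \<in> S" for x
    proof -
      have "restrict (?merge (y, x)) ?A = x"
        using x(1) by (auto simp: space_PiM)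
      then show ?thesis using step [of "?merge (y, x)"] x(2) v by (auto simp: S_def)
    qed
    then have "(\<integral>\<^sup>+x. indicator S (?merge (y, x)) \<partial>?GA) \<le> (\<integral>\<^sup>+x. indicator (Bad' v) x \<partial>?GA)"
      by (intro nn_integral_mono) (auto simp: indicator_def)
    also have "\<dots> = ennreal (measure ?GA (Bad' v))"
      using sets by (simp add: A.emeasure_eq_measure)
    finally show ?thesis using sets(2) by (meson ennreal_leI order_trans)
  next
    case False
    then have "(\<integral>\<^sup>+x. indicator S (?merge (y, x)) \<partial>?GA) = (\<integral>\<^sup>+x. 0 \<partial>?GA)"
      by (intro nn_integral_cong) auto
    then show ?thesis by simp
  qed
  have "emeasure (gauss_matrix I) S = (\<integral>\<^sup>+J. indicator S J \<partial>PiM (?B \<union> ?A) (\<lambda>_. gauss))"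
    using S AB(1) by simp
  also have "\<dots> = (\<integral>\<^sup>+y. \<integral>\<^sup>+x. indicator S (?merge (y, x)) \<partial>?GA \<partial>?GB)"
    by (rule gauss_prod.product_nn_integral_fold [OF AB(2-4)]) (use S AB(1) in simp)
  also have "\<dots> \<le> (\<integral>\<^sup>+y. ennreal p \<partial>?GB)"
    by (rule nn_integral_mono) (rule section_le)
  also have "\<dots> = ennreal p" by (simp add: B.emeasure_space_1)
  finally have "measure (gauss_matrix I) S \<le> p"
    using p by (simp add: emeasure_eq_measure)
  moreover have "measure (gauss_matrix I) Bad \<le> measure (gauss_matrix I) (Exc \<union> S)"
    by (rule finite_measure_mono [OF _ sets.Un [OF Exc S]]) (auto simp: S_def)
  moreover have "\<dots> \<le> measure (gauss_matrix I) Exc + measure (gauss_matrix I) S"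
    by (rule measure_Un_le [OF Exc S])
  ultimately show ?thesis using d by simp
qed

section \<open>Upper and lower bounds on the quadratic form\<close>

lemma mult_add_le_sqrt_mult_sqrt:
  fixes a b c d :: real
  shows "a * c + b * d \<le> sqrt (a\<^sup>2 + b\<^sup>2) * sqrt (c\<^sup>2 + d\<^sup>2)"
proof -
  have "(a\<^sup>2 + b\<^sup>2) * (c\<^sup>2 + d\<^sup>2) = (a * c + b * d)\<^sup>2 + (a * d - b * c)\<^sup>2"
    by (simp add: algebra_simps power2_eq_square)
  then have "(a * c + b * d)\<^sup>2 \<le> (a\<^sup>2 + b\<^sup>2) * (c\<^sup>2 + d\<^sup>2)" by simp
  then show ?thesis by (simp add: real_le_rsqrt flip: real_sqrt_mult)
qed

text \<open>For \<open>\<bar>u\<bar> = 1\<close> the square roots are the lengths of \<open>m\<close> and of its part orthogonal to \<open>u\<close>; by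
  duality the bound says that for every strength \<open>s\<close> the maximum of \<open>quad_form I J m + s * inner_on I u m\<close>
  over \<open>\<bar>m\<bar>\<^sup>2 = q\<close> is at most \<open>sqrt (s\<^sup>2 q + \<kappa>\<^sup>2 q\<^sup>2) + \<epsilon> q\<close>. In this form the strength has disappeared, and the
  bound becomes weaker as \<open>u\<close> shrinks, so that it can be used with \<open>\<bar>u\<bar> \<le> 1\<close> without normalising.\<close>

definition upper_dominated :: "real \<Rightarrow> real \<Rightarrow> 'k set \<Rightarrow> ('k \<Rightarrow> real) \<Rightarrow> ('k \<times> 'k \<Rightarrow> real) \<Rightarrow> bool" where
  "upper_dominated \<kappa> \<epsilon> I u J \<longleftrightarrow> (\<forall>m. quad_form I J m
     \<le> \<kappa> * sqrt (inner_on I m m) * sqrt (inner_on I m m - (inner_on I u m)\<^sup>2) + \<epsilon> * inner_on I m m)"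

text \<open>A vector that has at least the cosine \<open>\<alpha>\<close> with \<open>u\<close> (if \<open>\<bar>u\<bar> = 1\<close>) and a large Rayleigh quotient.
  The inequalities are strict, and therefore stable under small changes of \<open>m\<close>; this makes the
  property measurable in \<open>J\<close>. For \<open>\<alpha> \<ge> 0\<close> a witness remains one when \<open>u\<close> is
  lengthened, so that vectors with \<open>\<bar>u\<bar> \<ge> 1\<close> need not be normalised either.\<close>

definition lower_witness :: "real \<Rightarrow> real \<Rightarrow> 'k set \<Rightarrow> ('k \<Rightarrow> real) \<Rightarrow> ('k \<times> 'k \<Rightarrow> real) \<Rightarrow> bool" where
  "lower_witness \<alpha> e I u J \<longleftrightarrow>
     (\<exists>m. \<alpha> * sqrt (inner_on I m m) < inner_on I u m \<and> e * inner_on I m m < quad_form I J m)"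

lemma continuous_on_coordinate [continuous_intros]: "continuous_on S (\<lambda>m::'k \<Rightarrow> real. m i)"
  by (rule continuous_on_product_coordinates [THEN continuous_on_subset]) simp

lemma continuous_on_inner_on [continuous_intros]: "continuous_on S (\<lambda>m. inner_on I u m)"
  unfolding inner_on_def by (intro continuous_intros)

lemma continuous_on_inner_on_self [continuous_intros]: "continuous_on S (\<lambda>m. inner_on I m m)"
  unfolding inner_on_def by (intro continuous_intros)

lemma continuous_on_quad_form [continuous_intros]: "continuous_on S (\<lambda>m. quad_form I J m)"
  unfolding quad_form_def by (intro continuous_intros)

lemma measurable_quad_form:
  "(\<lambda>J. quad_form I J m) \<in> borel_measurable (gauss_matrix I)"
  unfolding quad_form_def
  by (intro borel_measurable_sum borel_measurable_times measurable_gauss_component) auto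

lemma measurable_inner_cross_part:
  assumes "i \<in> I"
  shows "(\<lambda>J. inner_on (I - {i}) (cross_part i J) (cross_part i J)) \<in> borel_measurable (gauss_matrix I)"
  unfolding inner_on_def cross_part_def
  by (intro borel_measurable_sum borel_measurable_times borel_measurable_add measurable_gauss_component)
    (use assms in auto)

text \<open>By continuity in \<open>m\<close>, a countable dense set of vectors suffices to detect a violation.\<close>

lemma sets_upper_dominated:
  fixes u :: "'k::countable \<Rightarrow> real"
  shows "{J \<in> space (gauss_matrix I). \<not> upper_dominated \<kappa> \<epsilon> I u J} \<in> sets (gauss_matrix I)"
proof -
  obtain D :: "('k \<Rightarrow> real) set" where D: "countable D"
    "\<And>U. open U \<Longrightarrow> U \<noteq> {} \<Longrightarrow> \<exists>x\<in>D. x \<in> U"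
    using countable_dense_setE by blast
  let ?R = "\<lambda>m. \<kappa> * sqrt (inner_on I m m) * sqrt (inner_on I m m - (inner_on I u m)\<^sup>2)
     + \<epsilon> * inner_on I m m"
  have "upper_dominated \<kappa> \<epsilon> I u J \<longleftrightarrow> (\<forall>m\<in>D. quad_form I J m \<le> ?R m)" for J
  proof
    assume *: "\<forall>m\<in>D. quad_form I J m \<le> ?R m"
    have "open {m. ?R m < quad_form I J m}"
      by (intro open_Collect_less continuous_intros)
    then have "{m. ?R m < quad_form I J m} \<noteq> {} \<Longrightarrow> \<exists>m\<in>D. m \<in> {m. ?R m < quad_form I J m}"
      by (rule D(2))
    then have "{m. ?R m < quad_form I J m} = {}"
      using * by (metis (mono_tags, lifting) mem_Collect_eq not_less)
    then show "upper_dominated \<kappa> \<epsilon> I u J" by (auto simp: upper_dominated_def not_less)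
  qed (simp add: upper_dominated_def)
  then have eq: "{J \<in> space (gauss_matrix I). \<not> upper_dominated \<kappa> \<epsilon> I u J}
      = (\<Union>m\<in>D. {J \<in> space (gauss_matrix I). ?R m < quad_form I J m})"
    by (auto simp: not_le)
  have "{J \<in> space (gauss_matrix I). x < quad_form I J m} \<in> sets (gauss_matrix I)" for x m
    by (intro borel_measurable_less measurable_quad_form) auto
  then show ?thesis unfolding eq by (intro sets.countable_UN' D(1)) blast
qed

lemma sets_lower_witness:
  fixes u :: "'k::countable \<Rightarrow> real"
  shows "{J \<in> space (gauss_matrix I). \<not> lower_witness \<alpha> e I u J} \<in> sets (gauss_matrix I)"
proof -
  obtain D :: "('k \<Rightarrow> real) set" where D: "countable D"
    "\<And>U. open U \<Longrightarrow> U \<noteq> {} \<Longrightarrow> \<exists>x\<in>D. x \<in> U"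
    using countable_dense_setE by blast
  let ?P = "\<lambda>m. \<alpha> * sqrt (inner_on I m m) < inner_on I u m"
  have "lower_witness \<alpha> e I u J \<longleftrightarrow> (\<exists>m\<in>{m \<in> D. ?P m}. e * inner_on I m m < quad_form I J m)" for J
  proof
    assume "lower_witness \<alpha> e I u J"
    then have ne: "{m. ?P m \<and> e * inner_on I m m < quad_form I J m} \<noteq> {}"
      by (auto simp: lower_witness_def)
    have "open {m. ?P m \<and> e * inner_on I m m < quad_form I J m}"
      by (intro open_Collect_conj open_Collect_less continuous_intros)
    then show "\<exists>m\<in>{m \<in> D. ?P m}. e * inner_on I m m < quad_form I J m"
      using D(2) [OF _ ne] by auto
  qed (auto simp: lower_witness_def)
  then have eq: "{J \<in> space (gauss_matrix I). \<not> lower_witness \<alpha> e I u J}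
      = space (gauss_matrix I) - (\<Union>m\<in>{m \<in> D. ?P m}. {J \<in> space (gauss_matrix I). e * inner_on I m m < quad_form I J m})"
    by auto
  have "countable {m \<in> D. ?P m}" using D(1) by (rule countable_subset [rotated]) auto
  moreover have "{J \<in> space (gauss_matrix I). e * inner_on I m m < quad_form I J m} \<in> sets (gauss_matrix I)" for m
    by (intro borel_measurable_less measurable_quad_form) auto
  ultimately have "(\<Union>m\<in>{m \<in> D. ?P m}. {J \<in> space (gauss_matrix I). e * inner_on I m m < quad_form I J m})
      \<in> sets (gauss_matrix I)"
    by (intro sets.countable_UN') blast+
  then show ?thesis unfolding eq by (rule sets.Diff [OF sets.top])
qed

lemma inner_on_axis:
  assumes "finite I" "i \<in> I" "\<forall>j\<in>I - {i}. v j = 0"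
  shows "inner_on I v m = v i * m i"
  unfolding inner_on_remove [OF assms(1,2)]
  using assms(3) by (simp add: inner_on_def)

lemma quad_form_restrict: "quad_form I (restrict J (I \<times> I)) m = quad_form I J m"
  by (simp add: quad_form_def)

text \<open>Put \<open>n = \<bar>m'\<bar>\<^sup>2\<close> for the part \<open>m'\<close> of \<open>m\<close> off the coordinate \<open>i\<close>, and let \<open>\<kappa> p\<close> be the value of the
  cross part at \<open>m'\<close>. The quadratic form is then at most
  \<open>\<kappa> (m i p + sqrt n * sqrt (n - p\<^sup>2)) + \<epsilon> \<bar>m\<bar>\<^sup>2\<close>, and by Cauchy-Schwarz in the plane the bracket is at
  most \<open>\<bar>m\<bar> sqrt n\<close>. This is the required bound because \<open>sqrt n\<close> is the length of the part
  orthogonal to the axis. The constants \<open>\<kappa>\<close> and \<open>\<epsilon>\<close> do not deteriorate, so the step can be repeated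
  as often as there are coordinates.\<close>

lemma upper_dominated_step:
  assumes I: "finite I" "i \<in> I" and v: "\<forall>j\<in>I - {i}. v j = 0" "inner_on I v v \<le> 1"
    and \<kappa>: "\<kappa> > 0" and diag: "J (i, i) \<le> \<epsilon>"
    and cross: "inner_on (I - {i}) (cross_part i J) (cross_part i J) \<le> \<kappa>\<^sup>2"
    and IH: "upper_dominated \<kappa> \<epsilon> (I - {i}) (\<lambda>a. cross_part i J a / \<kappa>) J"
  shows "upper_dominated \<kappa> \<epsilon> I v J"
  unfolding upper_dominated_def
proof
  fix m
  let ?I = "I - {i}"
  have axis: "inner_on I v x = v i * x i" for x by (rule inner_on_axis [OF I v(1)])
  define n where "n = inner_on ?I m m"
  define p where "p = inner_on ?I (cross_part i J) m / \<kappa>"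
  have n: "n \<ge> 0" by (simp add: n_def inner_on_self_nonneg)
  have "(inner_on ?I (cross_part i J) m)\<^sup>2 \<le> \<kappa>\<^sup>2 * n"
    using inner_on_Cauchy_Schwarz [of ?I "cross_part i J" m] mult_right_mono [OF cross n]
    by (simp add: n_def)
  then have p: "p\<^sup>2 \<le> n" using \<kappa> by (simp add: p_def power_divide field_simps)
  have mm: "inner_on I m m = (m i)\<^sup>2 + n"
    using I by (simp add: inner_on_remove n_def power2_eq_square)
  have vm: "(inner_on I v m)\<^sup>2 \<le> (m i)\<^sup>2"
    using v(2) mult_right_mono [of "(v i)\<^sup>2" 1 "(m i)\<^sup>2"]
    by (simp add: axis power_mult_distrib flip: power2_eq_square)
  have "quad_form ?I J m \<le> \<kappa> * sqrt n * sqrt (n - p\<^sup>2) + \<epsilon> * n"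
    using IH by (auto simp: upper_dominated_def inner_on_div n_def p_def)
  then have "quad_form I J m \<le> J (i, i) * (m i)\<^sup>2 + m i * (\<kappa> * p) + (\<kappa> * sqrt n * sqrt (n - p\<^sup>2) + \<epsilon> * n)"
    using \<kappa> unfolding quad_form_remove [OF I] by (simp add: p_def)
  also have "\<dots> \<le> \<kappa> * (m i * p + sqrt n * sqrt (n - p\<^sup>2)) + \<epsilon> * ((m i)\<^sup>2 + n)"
    using mult_right_mono [OF diag, of "(m i)\<^sup>2"] by (simp add: algebra_simps)
  also have "m i * p + sqrt n * sqrt (n - p\<^sup>2) \<le> sqrt ((m i)\<^sup>2 + n) * sqrt n"
    using mult_add_le_sqrt_mult_sqrt [of "m i" p "sqrt n" "sqrt (n - p\<^sup>2)"] n p by simp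
  also have "sqrt n \<le> sqrt (inner_on I m m - (inner_on I v m)\<^sup>2)"
    using vm mm by simp
  finally show "quad_form I J m
     \<le> \<kappa> * sqrt (inner_on I m m) * sqrt (inner_on I m m - (inner_on I v m)\<^sup>2) + \<epsilon> * inner_on I m m"
    using \<kappa> n by (simp add: mm mult_left_mono mult.assoc)
qed

lemma upper_dominated_rotate:
  assumes I: "finite I" "i \<in> I" "j \<in> I" "i \<noteq> j" "c\<^sup>2 + s\<^sup>2 = 1"
    and q: "\<And>m. quad_form I J' (rotate c s i j m) = quad_form I J m"
    and J': "upper_dominated \<kappa> \<epsilon> I (rotate c s i j u) J'"
  shows "upper_dominated \<kappa> \<epsilon> I u J"
  unfolding upper_dominated_def
proof
  fix m
  show "quad_form I J m \<le> \<kappa> * sqrt (inner_on I m m) *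
      sqrt (inner_on I m m - (inner_on I u m)\<^sup>2) + \<epsilon> * inner_on I m m"
    using J' [unfolded upper_dominated_def, rule_format, of "rotate c s i j m"]
    by (simp add: q inner_on_rotate [OF I])
qed

lemma lower_witness_rotate:
  assumes I: "finite I" "i \<in> I" "j \<in> I" "i \<noteq> j" "c\<^sup>2 + s\<^sup>2 = 1"
    and q: "\<And>m. quad_form I J' (rotate c s i j m) = quad_form I J m"
    and J': "lower_witness \<alpha> e I (rotate c s i j u) J'"
  shows "lower_witness \<alpha> e I u J"
proof -
  obtain m' where m': "\<alpha> * sqrt (inner_on I m' m') < inner_on I (rotate c s i j u) m'"
      "e * inner_on I m' m' < quad_form I J' m'"
    using J' by (auto simp: lower_witness_def)
  obtain m where "m' = rotate c s i j m" using rotate_surj [OF I(4,5)] by blast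
  then show ?thesis using m' unfolding lower_witness_def
    by (auto simp: q inner_on_rotate [OF I])
qed

text \<open>Induction on the dimension: rotate \<open>u\<close> to an axis, peel off that axis, and continue with the
  cross part divided by \<open>\<kappa>\<close>, which has length at most \<open>1\<close> off the exceptional event. There is one
  exceptional event per coordinate, hence the factor \<open>card I\<close>.\<close>

lemma upper_dominated_prob:
  fixes I :: "'k::countable set" and d :: real
  assumes \<kappa>: "\<kappa> > 0"
    and tail: "\<And>I i. finite (I::'k set) \<Longrightarrow> i \<in> I \<Longrightarrow> card I \<le> N \<Longrightarrow>
      measure (gauss_matrix I) {J \<in> space (gauss_matrix I).
        J (i, i) > \<epsilon> \<or> inner_on (I - {i}) (cross_part i J) (cross_part i J) > \<kappa>\<^sup>2} \<le> d"
    and d: "d \<ge> 0"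
    and I: "finite I" "card I \<le> N" "inner_on I u u \<le> 1"
  shows "measure (gauss_matrix I) {J \<in> space (gauss_matrix I). \<not> upper_dominated \<kappa> \<epsilon> I u J} \<le> card I * d"
  using I
proof (induction "card I" arbitrary: I u)
  case 0
  then have "I = {}" by simp
  then have "upper_dominated \<kappa> \<epsilon> I u J" for J
    by (simp add: upper_dominated_def quad_form_def inner_on_def)
  then show ?case using \<open>I = {}\<close> by simp
next
  case (Suc k)
  note [simp] = \<open>Suc k = card I\<close> [symmetric]
  have ne: "I \<noteq> {}" using Suc.hyps(2) by (metis card.empty nat.distinct(1))
  show ?case
  proof (rule measure_le_by_axis_reduction [OF \<open>finite I\<close> ne sets_upper_dominated])
    fix i j c s u and J J' :: "'k \<times> 'k \<Rightarrow> real"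
    assume ij: "i \<in> I" "j \<in> I" "i \<noteq> j" "c\<^sup>2 + s\<^sup>2 = (1::real)"
      and q: "\<And>m. quad_form I J' (rotate c s i j m) = quad_form I J m"
      and "\<not> upper_dominated \<kappa> \<epsilon> I u J"
    then show "\<not> upper_dominated \<kappa> \<epsilon> I (rotate c s i j u) J'"
      using upper_dominated_rotate [OF \<open>finite I\<close> ij q] by blast
  next
    fix i v assume i: "i \<in> I" and v: "\<forall>j\<in>I - {i}. v j = 0" "inner_on I v v = inner_on I u u"
    let ?G = "gauss_matrix I" and ?I = "I - {i}"
    let ?Exc = "{J \<in> space ?G. J (i, i) > \<epsilon> \<or> inner_on ?I (cross_part i J) (cross_part i J) > \<kappa>\<^sup>2}"
    let ?Bad' = "\<lambda>w. {J \<in> space (gauss_matrix ?I). \<not> upper_dominated \<kappa> \<epsilon> ?I (\<lambda>a. w a / \<kappa>) J}"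
    have card: "card ?I = k" using i Suc.hyps(2) \<open>finite I\<close> by simp
    have "measure ?G {J \<in> space ?G. \<not> upper_dominated \<kappa> \<epsilon> I v J} \<le> d + k * d"
    proof (rule measure_le_by_peeling [OF \<open>finite I\<close> i sets_upper_dominated, where Bad' = ?Bad' and Exc = ?Exc])
      have [measurable]: "(\<lambda>J. J (i, i)) \<in> borel_measurable ?G"
        "(\<lambda>J. inner_on ?I (cross_part i J) (cross_part i J)) \<in> borel_measurable ?G"
        using i by (auto intro!: measurable_gauss_component measurable_inner_cross_part)
      show "?Exc \<in> sets ?G" by measurable
      show "measure ?G ?Exc \<le> d" using tail [OF \<open>finite I\<close> i] Suc.prems by simp
      show "0 \<le> k * d" using d by simp
    next
      fix J assume J: "J \<in> {J \<in> space ?G. \<not> upper_dominated \<kappa> \<epsilon> I v J}" "J \<notin> ?Exc"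
      then have cross: "inner_on ?I (cross_part i J) (cross_part i J) \<le> \<kappa>\<^sup>2" "J (i, i) \<le> \<epsilon>"
        by auto
      have "\<not> upper_dominated \<kappa> \<epsilon> ?I (\<lambda>a. cross_part i J a / \<kappa>) J"
        using upper_dominated_step [where J = J and \<epsilon> = \<epsilon>, OF \<open>finite I\<close> i v(1) _ \<kappa> cross(2,1)] v(2) Suc.prems J by auto
      then have "\<not> upper_dominated \<kappa> \<epsilon> ?I (\<lambda>a. cross_part i J a / \<kappa>) (restrict J (?I \<times> ?I))"
        by (simp only: upper_dominated_def quad_form_restrict) simp
      moreover have "restrict J (?I \<times> ?I) \<in> space (gauss_matrix ?I)" by (simp add: space_PiM)
      moreover have "measure (gauss_matrix ?I) (?Bad' (cross_part i J)) \<le> card ?I * d"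
      proof (rule Suc.hyps(1))
        show "inner_on ?I (\<lambda>a. cross_part i J a / \<kappa>) (\<lambda>a. cross_part i J a / \<kappa>) \<le> 1"
          using cross(1) \<kappa> by (simp add: inner_on_div_self)
      qed (use card Suc.prems in simp_all)
      ultimately show "restrict J (?I \<times> ?I) \<in> ?Bad' (cross_part i J) \<and>
          ?Bad' (cross_part i J) \<in> sets (gauss_matrix ?I) \<and>
          measure (gauss_matrix ?I) (?Bad' (cross_part i J)) \<le> k * d"
        using card sets_upper_dominated by auto
    qed
    then show "measure ?G {J \<in> space ?G. \<not> upper_dominated \<kappa> \<epsilon> I v J} \<le> card I * d"
      by (simp add: algebra_simps)
  qed
qed

text \<open>The witness is the direction of the axis itself.\<close>

lemma lower_witness_base:
  assumes I: "finite I" "i \<in> I" and v: "\<forall>j\<in>I - {i}. v j = 0" "inner_on I v v \<ge> 1"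
    and \<alpha>: "\<alpha> < 1" and diag: "J (i, i) > - \<epsilon>"
  shows "lower_witness \<alpha> (- \<epsilon>) I v J"
proof -
  have axis: "inner_on I v x = v i * x i" for x by (rule inner_on_axis [OF I v(1)])
  define m where "m = (\<lambda>j. if j = i then sgn (v i) else 0)"
  have vi: "v i * v i \<ge> 1" using v(2) by (simp add: axis)
  then have nz: "v i \<noteq> 0" by auto
  have "1 \<le> \<bar>v i\<bar>" using vi by (simp add: abs_le_square_iff [of 1 "v i", simplified] power2_eq_square)
  moreover have "inner_on I v m = \<bar>v i\<bar>" by (simp add: axis m_def abs_sgn)
  moreover have "inner_on (I - {i}) x m = 0" for x by (auto simp: inner_on_def m_def intro!: sum.neutral)
  then have "inner_on I m m = 1" "quad_form I J m = J (i, i)"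
    using nz by (simp_all add: inner_on_remove [OF I] quad_form_remove [OF I])
      (simp_all add: m_def power2_eq_square quad_form_def sgn_if)
  ultimately show ?thesis using \<alpha> diag by (auto simp: lower_witness_def intro!: exI [of _ m])
qed

text \<open>Take \<open>m = (a, b m')\<close>, up to a sign, for a unit witness \<open>m'\<close> of the smaller matrix. The cross part of
  length about \<open>\<kappa>\<close> has at least the cosine \<open>\<alpha>\<close> with \<open>m'\<close>, which yields the term \<open>a b \<kappa> \<alpha>\<close>; so the cosine in the
  definition of a witness is what keeps the recursion going.\<close>

lemma lower_witness_step:
  assumes I: "finite I" "i \<in> I" and v: "\<forall>j\<in>I - {i}. v j = 0" "inner_on I v v \<ge> 1"
    and ab: "a > 0" "b \<ge> 0" "a\<^sup>2 + b\<^sup>2 = 1" "\<alpha> < a" and \<kappa>: "\<kappa> > 0" and diag: "J (i, i) > - \<epsilon>"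
    and IH: "lower_witness \<alpha> e (I - {i}) (\<lambda>k. cross_part i J k / \<kappa>) J"
  shows "lower_witness \<alpha> (- \<epsilon> * a\<^sup>2 + a * b * \<kappa> * \<alpha> + b\<^sup>2 * e) I v J"
proof -
  let ?I = "I - {i}"
  obtain m' where m': "\<alpha> * sqrt (inner_on ?I m' m') < inner_on ?I (cross_part i J) m' / \<kappa>"
    "e * inner_on ?I m' m' < quad_form ?I J m'"
    using IH by (auto simp: lower_witness_def inner_on_div)
  define n where "n = inner_on ?I m' m'"
  have n0: "n \<noteq> 0"
    using m'(1) inner_on_Cauchy_Schwarz [of ?I "cross_part i J" m'] by (auto simp: n_def)
  then have n: "n > 0" using inner_on_self_nonneg [of ?I m'] by (simp add: n_def)
  have axis: "inner_on I v x = v i * x i" for x by (rule inner_on_axis [OF I v(1)])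
  have vi: "v i * v i \<ge> 1" using v(2) by (simp add: axis)
  then have nz: "v i \<noteq> 0" by auto
  have vi1: "1 \<le> \<bar>v i\<bar>" using vi by (simp add: abs_le_square_iff [of 1 "v i", simplified] power2_eq_square)
  define m where "m = (\<lambda>j. if j = i then a * sqrt n else b * m' j)"
  have on_I: "inner_on ?I x m = b * inner_on ?I x m'" for x
    by (auto simp: inner_on_def m_def sum_distrib_left intro!: sum.cong)
  have mm: "inner_on I m m = n"
  proof -
    have "inner_on ?I m m = inner_on ?I (\<lambda>j. b * m' j) (\<lambda>j. b * m' j)"
      by (rule inner_on_cong) (auto simp: m_def)
    then have "inner_on I m m = a * a * (sqrt n * sqrt n) + b * b * n"
      by (simp add: inner_on_remove [OF I] inner_on_scale n_def) (simp add: m_def n_def)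
    also have "\<dots> = (a\<^sup>2 + b\<^sup>2) * n" using n by (simp add: power2_eq_square algebra_simps)
    finally show ?thesis using ab(3) by simp
  qed
  have "quad_form ?I J m = quad_form ?I J (\<lambda>j. b * m' j)"
    by (auto simp: quad_form_def m_def intro!: sum.cong)
  then have Q: "quad_form I J m = J (i, i) * (a * sqrt n)\<^sup>2
      + a * sqrt n * (b * inner_on ?I (cross_part i J) m') + b\<^sup>2 * quad_form ?I J m'"
    unfolding quad_form_remove [OF I] on_I quad_form_scale by (simp add: m_def)
  have 1: "- \<epsilon> * (a\<^sup>2 * n) < J (i, i) * (a * sqrt n)\<^sup>2"
    using mult_strict_right_mono [OF diag, of "a\<^sup>2 * n"] ab n by (simp add: power_mult_distrib)
  have "\<kappa> * (\<alpha> * sqrt n) \<le> inner_on ?I (cross_part i J) m'"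
    using m'(1) \<kappa> by (simp add: n_def field_simps)
  then have "a * sqrt n * b * (\<kappa> * (\<alpha> * sqrt n)) \<le> a * sqrt n * b * inner_on ?I (cross_part i J) m'"
    using ab n by (intro mult_left_mono) auto
  also have "a * sqrt n * b * (\<kappa> * (\<alpha> * sqrt n)) = a * b * \<kappa> * \<alpha> * (sqrt n * sqrt n)"
    by (simp only: mult_ac)
  finally have 2: "a * b * \<kappa> * \<alpha> * n \<le> a * sqrt n * (b * inner_on ?I (cross_part i J) m')"
    using n by (simp add: mult.assoc)
  have 3: "b\<^sup>2 * (e * n) \<le> b\<^sup>2 * quad_form ?I J m'"
    using m'(2) by (intro mult_left_mono) (auto simp: n_def)
  have Qm: "(- \<epsilon> * a\<^sup>2 + a * b * \<kappa> * \<alpha> + b\<^sup>2 * e) * n < quad_form I J m"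
    unfolding Q using 1 2 3 by (simp add: algebra_simps)
  \<comment> \<open>An overall sign makes the component along \<open>v\<close> positive and leaves the quadratic form alone.\<close>
  define m1 where "m1 = (\<lambda>j. sgn (v i) * m j)"
  have s: "sgn (v i) * sgn (v i) = 1" using nz by (simp add: sgn_if)
  have "inner_on I m1 m1 = n" "quad_form I J m1 = quad_form I J m"
    using s by (simp_all add: m1_def inner_on_scale quad_form_scale mm power2_eq_square
        flip: mult.assoc)
  moreover have "inner_on I v m1 = \<bar>v i\<bar> * (a * sqrt n)"
    by (simp add: axis m1_def m_def abs_sgn mult_ac)
  moreover have "\<alpha> * sqrt n < \<bar>v i\<bar> * (a * sqrt n)"
  proof -
    have "\<alpha> * sqrt n < 1 * (a * sqrt n)" using ab n by simp
    also have "\<dots> \<le> \<bar>v i\<bar> * (a * sqrt n)" using vi1 ab n by (intro mult_right_mono) auto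
    finally show ?thesis .
  qed
  ultimately show ?thesis using Qm by (auto simp: lower_witness_def intro!: exI [of _ m1])
qed

text \<open>After \<open>k\<close> steps the recursion \<open>e' = - \<epsilon> a\<^sup>2 + a b \<kappa> \<alpha> + b\<^sup>2 e\<close>, started at \<open>- \<epsilon>\<close>, has reached the value in
  the statement; it converges geometrically to \<open>\<kappa> \<alpha> b / a - \<epsilon>\<close>, so that finitely many steps, and
  hence finitely many exceptional events, suffice for any accuracy.\<close>

lemma lower_witness_prob:
  fixes I :: "'k::countable set" and d :: real
  assumes ab: "a > 0" "b \<ge> 0" "a\<^sup>2 + b\<^sup>2 = 1" "\<alpha> < a" and \<kappa>: "\<kappa> > 0"
    and tail: "\<And>I i. finite (I::'k set) \<Longrightarrow> i \<in> I \<Longrightarrow> card I > L \<Longrightarrow>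
      measure (gauss_matrix I) {J \<in> space (gauss_matrix I).
        J (i, i) \<le> - \<epsilon> \<or> inner_on (I - {i}) (cross_part i J) (cross_part i J) < \<kappa>\<^sup>2} \<le> d"
    and d: "d \<ge> 0"
    and I: "finite I" "card I > L + k" "inner_on I u u \<ge> 1"
  shows "measure (gauss_matrix I) {J \<in> space (gauss_matrix I).
      \<not> lower_witness \<alpha> (- \<epsilon> + (1 - b ^ (2 * k)) * (\<kappa> * \<alpha> * b / a)) I u J} \<le> Suc k * d"
proof -
  define e where "e k = - \<epsilon> + (1 - b ^ (2 * k)) * (\<kappa> * \<alpha> * b / a)" for k
  have e_Suc: "- \<epsilon> * a\<^sup>2 + a * b * \<kappa> * \<alpha> + b\<^sup>2 * e k = e (Suc k)" for k
  proof -
    have "- \<epsilon> * a\<^sup>2 + a * b * \<kappa> * \<alpha> + b\<^sup>2 * e k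
        = - \<epsilon> * (a\<^sup>2 + b\<^sup>2) + (a\<^sup>2 + b\<^sup>2 - b\<^sup>2 * b ^ (2 * k)) * (\<kappa> * \<alpha> * b / a)"
      using ab(1) by (simp add: e_def field_simps power2_eq_square)
    also have "\<dots> = e (Suc k)"
      by (simp only: ab(3) e_def) (simp add: power2_eq_square)
    finally show ?thesis .
  qed
  have \<alpha>: "\<alpha> < 1"
  proof -
    have "a\<^sup>2 \<le> 1\<^sup>2" using ab(3) zero_le_power2 [of b] unfolding one_power2 by linarith
    then have "a \<le> 1" by (rule power2_le_imp_le) simp
    then show ?thesis using ab(4) by simp
  qed
  have "measure (gauss_matrix I) {J \<in> space (gauss_matrix I). \<not> lower_witness \<alpha> (e k) I u J} \<le> Suc k * d"
    using I
  proof (induction k arbitrary: I u)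
    case (0 I u)
    let ?G = "gauss_matrix I"
    interpret prob_space ?G by (rule prob_space_gauss_PiM)
    have ne: "I \<noteq> {}" using 0 by auto
    show ?case
    proof (rule measure_le_by_axis_reduction [OF \<open>finite I\<close> ne sets_lower_witness])
      fix i j c s u and J J' :: "'k \<times> 'k \<Rightarrow> real"
      assume ij: "i \<in> I" "j \<in> I" "i \<noteq> j" "c\<^sup>2 + s\<^sup>2 = (1::real)"
        and q: "\<And>m. quad_form I J' (rotate c s i j m) = quad_form I J m"
        and "\<not> lower_witness \<alpha> (e 0) I u J"
      then show "\<not> lower_witness \<alpha> (e 0) I (rotate c s i j u) J'"
        using lower_witness_rotate [OF \<open>finite I\<close> ij q] by blast
    next
      fix i v assume i: "i \<in> I" and v: "\<forall>j\<in>I - {i}. v j = 0" "inner_on I v v = inner_on I u u"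
      let ?Exc = "{J \<in> space ?G. J (i, i) \<le> - \<epsilon> \<or> inner_on (I - {i}) (cross_part i J) (cross_part i J) < \<kappa>\<^sup>2}"
      have [measurable]: "(\<lambda>J. J (i, i)) \<in> borel_measurable ?G"
        "(\<lambda>J. inner_on (I - {i}) (cross_part i J) (cross_part i J)) \<in> borel_measurable ?G"
        using i by (auto intro!: measurable_gauss_component measurable_inner_cross_part)
      have "measure ?G {J \<in> space ?G. \<not> lower_witness \<alpha> (e 0) I v J} \<le> measure ?G ?Exc"
      proof (rule finite_measure_mono)
        show "?Exc \<in> sets ?G" by measurable
        show "{J \<in> space ?G. \<not> lower_witness \<alpha> (e 0) I v J} \<subseteq> ?Exc"
        proof
          fix J assume J: "J \<in> {J \<in> space ?G. \<not> lower_witness \<alpha> (e 0) I v J}"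
          have "lower_witness \<alpha> (e 0) I v J" if "- \<epsilon> < J (i, i)"
            using lower_witness_base [where J = J and \<epsilon> = \<epsilon>, OF \<open>finite I\<close> i v(1) _ \<alpha> that] v(2) 0 by (simp add: e_def)
          with J show "J \<in> ?Exc" by fastforce
        qed
      qed
      also have "\<dots> \<le> d" using tail [OF \<open>finite I\<close> i] 0 by simp
      finally show "measure ?G {J \<in> space ?G. \<not> lower_witness \<alpha> (e 0) I v J} \<le> Suc 0 * d" by simp
    qed
  next
    case (Suc k I u)
    let ?G = "gauss_matrix I"
    have ne: "I \<noteq> {}" using Suc.prems by auto
    show ?case
    proof (rule measure_le_by_axis_reduction [OF \<open>finite I\<close> ne sets_lower_witness])
      fix i j c s u and J J' :: "'k \<times> 'k \<Rightarrow> real"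
      assume ij: "i \<in> I" "j \<in> I" "i \<noteq> j" "c\<^sup>2 + s\<^sup>2 = (1::real)"
        and q: "\<And>m. quad_form I J' (rotate c s i j m) = quad_form I J m"
        and "\<not> lower_witness \<alpha> (e (Suc k)) I u J"
      then show "\<not> lower_witness \<alpha> (e (Suc k)) I (rotate c s i j u) J'"
        using lower_witness_rotate [OF \<open>finite I\<close> ij q] by blast
    next
      fix i v assume i: "i \<in> I" and v: "\<forall>j\<in>I - {i}. v j = 0" "inner_on I v v = inner_on I u u"
      let ?I = "I - {i}"
      let ?Exc = "{J \<in> space ?G. J (i, i) \<le> - \<epsilon> \<or> inner_on ?I (cross_part i J) (cross_part i J) < \<kappa>\<^sup>2}"
      let ?Bad' = "\<lambda>w. {J \<in> space (gauss_matrix ?I). \<not> lower_witness \<alpha> (e k) ?I (\<lambda>a. w a / \<kappa>) J}"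
      have "measure ?G {J \<in> space ?G. \<not> lower_witness \<alpha> (e (Suc k)) I v J} \<le> d + Suc k * d"
      proof (rule measure_le_by_peeling [OF \<open>finite I\<close> i sets_lower_witness, where Bad' = ?Bad' and Exc = ?Exc])
        have [measurable]: "(\<lambda>J. J (i, i)) \<in> borel_measurable ?G"
          "(\<lambda>J. inner_on ?I (cross_part i J) (cross_part i J)) \<in> borel_measurable ?G"
          using i by (auto intro!: measurable_gauss_component measurable_inner_cross_part)
        show "?Exc \<in> sets ?G" by measurable
        show "measure ?G ?Exc \<le> d" using tail [OF \<open>finite I\<close> i] Suc.prems by simp
        show "0 \<le> Suc k * d" using d by simp
      next
        fix J assume J: "J \<in> {J \<in> space ?G. \<not> lower_witness \<alpha> (e (Suc k)) I v J}" "J \<notin> ?Exc"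
        then have cross: "inner_on ?I (cross_part i J) (cross_part i J) \<ge> \<kappa>\<^sup>2" "J (i, i) > - \<epsilon>"
          by auto
        have "\<not> lower_witness \<alpha> (e k) ?I (\<lambda>a. cross_part i J a / \<kappa>) J"
          using lower_witness_step [where J = J and \<epsilon> = \<epsilon> and e = "e k", OF \<open>finite I\<close> i v(1) _ ab \<kappa> cross(2)] v(2) Suc.prems J
          unfolding e_Suc by auto
        then have "\<not> lower_witness \<alpha> (e k) ?I (\<lambda>a. cross_part i J a / \<kappa>) (restrict J (?I \<times> ?I))"
          by (simp only: lower_witness_def quad_form_restrict) simp
        moreover have "restrict J (?I \<times> ?I) \<in> space (gauss_matrix ?I)" by (simp add: space_PiM)
        moreover have "measure (gauss_matrix ?I) (?Bad' (cross_part i J)) \<le> Suc k * d"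
        proof (rule Suc.IH)
          show "1 \<le> inner_on ?I (\<lambda>a. cross_part i J a / \<kappa>) (\<lambda>a. cross_part i J a / \<kappa>)"
            using cross(1) \<kappa> by (simp add: inner_on_div_self)
          show "L + k < card ?I" using Suc.prems i by simp
        qed (use Suc.prems in simp)
        ultimately show "restrict J (?I \<times> ?I) \<in> ?Bad' (cross_part i J) \<and>
            ?Bad' (cross_part i J) \<in> sets (gauss_matrix ?I) \<and>
            measure (gauss_matrix ?I) (?Bad' (cross_part i J)) \<le> Suc k * d"
          using sets_lower_witness by auto
      qed
      then show "measure ?G {J \<in> space ?G. \<not> lower_witness \<alpha> (e (Suc k)) I v J} \<le> Suc (Suc k) * d"
        by (simp add: algebra_simps)
    qed
  qed
  then show ?thesis by (simp add: e_def)
qed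

text \<open>The Chernoff rate per degree of freedom for a sum of squares of Gaussians to deviate from its mean
  by the factor \<open>r\<close>, in either direction.\<close>

section \<open>Large dimension\<close>

definition tail_rate :: "real \<Rightarrow> real" where
  "tail_rate r = sqrt r * exp ((1 - r) / 2)"

lemma tail_rate_bounds:
  assumes "r > 0" "r \<noteq> 1"
  shows "0 \<le> tail_rate r" "tail_rate r < 1"
proof -
  show "0 \<le> tail_rate r" using assms by (simp add: tail_rate_def)
  have "ln r < r - 1"
    using ln_le_minus_one [of r] ln_eq_minus_one [of r] assms by fastforce
  then have "exp (ln r) < exp (r - 1)" by (simp only: exp_less_cancel_iff)
  then have "r < exp (r - 1)" using assms by simp
  then have "r * exp (1 - r) < exp (r - 1) * exp (1 - r)" by simp
  then have "r * exp (1 - r) < 1" by (simp add: mult_exp_exp)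
  moreover have "(tail_rate r)\<^sup>2 = r * exp (1 - r)"
    using assms by (simp add: tail_rate_def power_mult_distrib exp_double [symmetric])
  ultimately have "(tail_rate r)\<^sup>2 < 1\<^sup>2" by simp
  then show "tail_rate r < 1" by (rule power2_less_imp_less) simp
qed

text \<open>The factor \<open>r - 1\<close> on both sides of the second alternative selects the upper tail if \<open>r > 1\<close> and the
  lower tail if \<open>r < 1\<close>.\<close>

lemma exceptional_tail:
  fixes I :: "'k set"
  assumes I: "finite I" "i \<in> I" and \<eta>: "\<eta> \<ge> 0" and r: "r > 0"
  shows "measure (gauss_matrix I) {J \<in> space (gauss_matrix I). \<eta> * sqrt (real N) \<le> \<bar>J (i, i)\<bar> \<or>
        (r - 1) * (2 * r * real N) \<le> (r - 1) * inner_on (I - {i}) (cross_part i J) (cross_part i J)}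
     \<le> sqrt 2 * exp (- \<eta>\<^sup>2 / 4) ^ N + sqrt r ^ (card I - 1) * exp ((1 - r) / 2) ^ N"
proof -
  let ?G = "gauss_matrix I"
  let ?W = "\<lambda>J. inner_on (I - {i}) (cross_part i J) (cross_part i J)"
  \<comment> \<open>The exponent that is optimal for the threshold \<open>r\<close>; it has the sign of \<open>r - 1\<close>.\<close>
  define t where "t = (1 - 1 / r) / 2"
  have t: "t < 1 / 2" "1 - 2 * t = 1 / r" "t * r = (r - 1) / 2" using r by (auto simp: t_def field_simps)
  interpret prob_space ?G by (rule prob_space_gauss_PiM)
  let ?S1 = "{J \<in> space ?G. \<eta>\<^sup>2 * N / 4 \<le> 1 / 4 * (\<Sum>z\<in>{(i, i)}. (J z)\<^sup>2)}"
  let ?S2 = "{J \<in> space ?G. 2 * (t * r * N) \<le> t * ?W J}"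
  have m [measurable]: "(\<lambda>J. J (i, i)) \<in> borel_measurable ?G" "?W \<in> borel_measurable ?G"
    using I by (auto intro!: measurable_gauss_component measurable_inner_cross_part)
  have sets: "?S1 \<in> sets ?G" "?S2 \<in> sets ?G" by simp_all
  have "measure ?G ?S1 \<le> (1 / sqrt (1 - 2 * (1 / 4))) ^ card {(i, i)} * exp (- (\<eta>\<^sup>2 * N / 4))"
    by (rule gauss_square_sum_tail) (use I in auto)
  then have 1: "measure ?G ?S1 \<le> sqrt 2 * exp (- \<eta>\<^sup>2 / 4) ^ N"
    by (simp add: real_sqrt_divide exp_of_nat_mult [symmetric] mult.commute)
  have "measure ?G ?S2 \<le> (1 / sqrt (1 - 2 * t)) ^ (card I - 1) * exp (- (t * r * N))"
    by (rule cross_part_tail [OF I t(1)])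
  also have "\<dots> = sqrt r ^ (card I - 1) * exp ((1 - r) / 2) ^ N"
    unfolding t(2,3) using r
    by (simp add: real_sqrt_divide exp_of_nat_mult [symmetric] field_simps)
  finally have 2: "measure ?G ?S2 \<le> sqrt r ^ (card I - 1) * exp ((1 - r) / 2) ^ N" .
  have "{J \<in> space ?G. \<eta> * sqrt N \<le> \<bar>J (i, i)\<bar> \<or> (r - 1) * (2 * r * N) \<le> (r - 1) * ?W J} \<subseteq> ?S1 \<union> ?S2"
  proof (intro subsetI, elim CollectE conjE disjE)
    fix J assume J: "J \<in> space ?G" "\<eta> * sqrt N \<le> \<bar>J (i, i)\<bar>"
    then have "(\<eta> * sqrt N)\<^sup>2 \<le> \<bar>J (i, i)\<bar>\<^sup>2" using \<eta> by (intro power_mono) auto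
    then show "J \<in> ?S1 \<union> ?S2" using J by (simp add: power_mult_distrib)
  next
    fix J assume J: "J \<in> space ?G" "(r - 1) * (2 * r * N) \<le> (r - 1) * ?W J"
    then have "(r - 1) * (2 * r * N) / (2 * r) \<le> (r - 1) * ?W J / (2 * r)"
      using r by (intro divide_right_mono) auto
    moreover have "(r - 1) * (2 * r * N) / (2 * r) = 2 * (t * r * N)" "(r - 1) * ?W J / (2 * r) = t * ?W J"
      using r by (simp_all add: t_def field_simps)
    ultimately show "J \<in> ?S1 \<union> ?S2" using J by simp
  qed
  then have "measure ?G {J \<in> space ?G. \<eta> * sqrt N \<le> \<bar>J (i, i)\<bar> \<or> (r - 1) * (2 * r * N) \<le> (r - 1) * ?W J}
      \<le> measure ?G (?S1 \<union> ?S2)"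
    by (rule finite_measure_mono) (use sets in blast)
  also have "\<dots> \<le> measure ?G ?S1 + measure ?G ?S2" by (rule measure_Un_le [OF sets])
  finally show ?thesis using 1 2 by simp
qed

text \<open>The upper bound needs all \<open>N\<close> peeling steps. Its failure probability still vanishes, since each
  exceptional event is exponentially rare. The threshold stays at its value for dimension \<open>N\<close> while
  the dimension decreases, which only makes these events rarer.\<close>

lemma upper_dominated_iid:
  fixes I :: "nat set" and u :: "nat \<Rightarrow> real"
  assumes s: "s > 1" and \<eta>: "\<eta> \<ge> 0" and I: "finite I" "card I = N" "N \<ge> 1" "inner_on I u u \<le> 1"
  shows "measure (gauss_matrix I) {J \<in> space (gauss_matrix I).
        \<not> upper_dominated (s * sqrt (2 * real N)) (\<eta> * sqrt N) I u J}
     \<le> N * (sqrt 2 * exp (- \<eta>\<^sup>2 / 4) ^ N + tail_rate (s\<^sup>2) ^ N)"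
proof -
  have s2: "s\<^sup>2 > 1" using s by (simp add: one_less_power)
  have \<kappa>2: "(s * sqrt (2 * real N))\<^sup>2 = 2 * s\<^sup>2 * N" by (simp add: power_mult_distrib)
  show ?thesis
    unfolding I(2) [symmetric]
  proof (rule upper_dominated_prob)
    fix K :: "nat set" and i
    assume K: "finite K" "i \<in> K" "card K \<le> card I"
    let ?G = "gauss_matrix K"
    let ?W = "\<lambda>J. inner_on (K - {i}) (cross_part i J) (cross_part i J)"
    interpret prob_space ?G by (rule prob_space_gauss_PiM)
    have [measurable]: "(\<lambda>J. J (i, i)) \<in> borel_measurable ?G" "?W \<in> borel_measurable ?G"
      using K by (auto intro!: measurable_gauss_component measurable_inner_cross_part)
    have "measure ?G {J \<in> space ?G. \<eta> * sqrt (card I) < J (i, i) \<or> (s * sqrt (2 * real (card I)))\<^sup>2 < ?W J}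
        \<le> measure ?G {J \<in> space ?G. \<eta> * sqrt (real (card I)) \<le> \<bar>J (i, i)\<bar> \<or>
            (s\<^sup>2 - 1) * (2 * s\<^sup>2 * real (card I)) \<le> (s\<^sup>2 - 1) * ?W J}"
    proof (rule finite_measure_mono)
      show "{J \<in> space ?G. \<eta> * sqrt (real (card I)) \<le> \<bar>J (i, i)\<bar> \<or>
            (s\<^sup>2 - 1) * (2 * s\<^sup>2 * real (card I)) \<le> (s\<^sup>2 - 1) * ?W J} \<in> sets ?G" by simp
    qed (use s2 in \<open>auto simp: \<kappa>2 [unfolded I(2) [symmetric]]\<close>)
    also have "\<dots> \<le> sqrt 2 * exp (- \<eta>\<^sup>2 / 4) ^ card I + sqrt (s\<^sup>2) ^ (card K - 1) * exp ((1 - s\<^sup>2) / 2) ^ card I"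
      by (rule exceptional_tail) (use K \<eta> s2 in auto)
    also have "sqrt (s\<^sup>2) ^ (card K - 1) \<le> sqrt (s\<^sup>2) ^ card I"
      by (rule power_increasing) (use K s in auto)
    finally show "measure ?G {J \<in> space ?G. \<eta> * sqrt (card I) < J (i, i) \<or> (s * sqrt (2 * real (card I)))\<^sup>2 < ?W J}
        \<le> sqrt 2 * exp (- \<eta>\<^sup>2 / 4) ^ card I + tail_rate (s\<^sup>2) ^ card I"
      by (simp add: tail_rate_def power_mult_distrib mult_right_mono)
  qed (use s I tail_rate_bounds [of "s\<^sup>2"] s2 in \<open>auto intro!: add_nonneg_nonneg\<close>)
qed

text \<open>The cross parts must not be too short here, but only \<open>k\<close> steps are taken, and each of the matrices
  that occur has dimension at least \<open>N - k\<close>; the denominator \<open>s ^ Suc k\<close> pays for the missing degrees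
  of freedom.\<close>

lemma lower_witness_iid:
  fixes I :: "nat set" and u :: "nat \<Rightarrow> real"
  assumes s: "0 < s" "s < 1" and \<eta>: "\<eta> \<ge> 0" and ab: "a > 0" "b \<ge> 0" "a\<^sup>2 + b\<^sup>2 = 1"
    and I: "finite I" "card I = N" "N > k" "inner_on I u u \<ge> 1"
  shows "measure (gauss_matrix I) {J \<in> space (gauss_matrix I).
        \<not> lower_witness (s * a) (sqrt N * (s\<^sup>2 * (1 - b ^ (2 * k)) * sqrt 2 * b - \<eta>)) I u J}
     \<le> Suc k * (sqrt 2 * exp (- \<eta>\<^sup>2 / 4) ^ N + tail_rate (s\<^sup>2) ^ N / s ^ Suc k)"
proof -
  have s2: "s\<^sup>2 < 1" using s by (simp add: power_less_one_iff)
  define L where "L = N - Suc k"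
  have L: "N = L + Suc k" using I(3) by (simp add: L_def)
  have e: "sqrt N * (s\<^sup>2 * (1 - b ^ (2 * k)) * sqrt 2 * b - \<eta>)
      = - (\<eta> * sqrt N) + (1 - b ^ (2 * k)) * ((s * sqrt (2 * real N)) * (s * a) * b / a)"
    using ab(1) by (simp add: real_sqrt_mult power2_eq_square field_simps)
  have \<kappa>2: "(s * sqrt (2 * real N))\<^sup>2 = 2 * s\<^sup>2 * N" by (simp add: power_mult_distrib)
  show ?thesis
    unfolding e
  proof (rule lower_witness_prob [where L = L])
    fix K :: "nat set" and i
    assume K: "finite K" "i \<in> K" "L < card K"
    let ?G = "gauss_matrix K"
    let ?W = "\<lambda>J. inner_on (K - {i}) (cross_part i J) (cross_part i J)"
    interpret prob_space ?G by (rule prob_space_gauss_PiM)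
    have [measurable]: "(\<lambda>J. J (i, i)) \<in> borel_measurable ?G" "?W \<in> borel_measurable ?G"
      using K by (auto intro!: measurable_gauss_component measurable_inner_cross_part)
    have "measure ?G {J \<in> space ?G. J (i, i) \<le> - (\<eta> * sqrt N) \<or> ?W J < (s * sqrt (2 * real N))\<^sup>2}
        \<le> measure ?G {J \<in> space ?G. \<eta> * sqrt (real N) \<le> \<bar>J (i, i)\<bar> \<or>
            (s\<^sup>2 - 1) * (2 * s\<^sup>2 * real N) \<le> (s\<^sup>2 - 1) * ?W J}"
    proof (rule finite_measure_mono)
      show "{J \<in> space ?G. \<eta> * sqrt (real N) \<le> \<bar>J (i, i)\<bar> \<or>
            (s\<^sup>2 - 1) * (2 * s\<^sup>2 * real N) \<le> (s\<^sup>2 - 1) * ?W J} \<in> sets ?G" by simp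
    qed (use s2 in \<open>auto simp: \<kappa>2\<close>)
    also have "\<dots> \<le> sqrt 2 * exp (- \<eta>\<^sup>2 / 4) ^ N + sqrt (s\<^sup>2) ^ (card K - 1) * exp ((1 - s\<^sup>2) / 2) ^ N"
      by (rule exceptional_tail) (use K \<eta> s in auto)
    also have "sqrt (s\<^sup>2) ^ (card K - 1) \<le> sqrt (s\<^sup>2) ^ L"
      by (rule power_decreasing) (use K s in auto)
    also have "sqrt (s\<^sup>2) ^ L = sqrt (s\<^sup>2) ^ N / s ^ Suc k"
      using s unfolding L power_add by simp
    finally show "measure ?G {J \<in> space ?G. J (i, i) \<le> - (\<eta> * sqrt N) \<or> ?W J < (s * sqrt (2 * real N))\<^sup>2}
        \<le> sqrt 2 * exp (- \<eta>\<^sup>2 / 4) ^ N + tail_rate (s\<^sup>2) ^ N / s ^ Suc k"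
      by (simp add: tail_rate_def power_mult_distrib mult_right_mono)
  qed (use s I L ab tail_rate_bounds [of "s\<^sup>2"] s2 in \<open>auto intro!: add_nonneg_nonneg\<close>)
qed


section \<open>The limiting variational formula\<close>

definition B_real :: "real \<Rightarrow> real \<Rightarrow> real \<Rightarrow> real" where
  "B_real \<beta> h q = sqrt (h\<^sup>2 * q + 2 * \<beta>\<^sup>2 * q\<^sup>2) + 1 / 2 * ln (1 - q) + \<beta>\<^sup>2 / 2 * (1 - q)\<^sup>2"

lemma B_TAP_eq: "q \<noteq> 1 \<Longrightarrow> B_TAP \<beta> h q = ereal (B_real \<beta> h q)"
  by (simp add: B_TAP_def B_real_def log_ext_def)

lemma field_term_le:
  assumes "0 \<le> q" "q \<le> 1"
  shows "sqrt (h\<^sup>2 * q + 2 * \<beta>\<^sup>2 * q\<^sup>2) \<le> sqrt (h\<^sup>2 + 2 * \<beta>\<^sup>2)"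
proof -
  have "q\<^sup>2 \<le> 1" using assms by (simp add: power_le_one)
  then have "h\<^sup>2 * q \<le> h\<^sup>2 * 1" "2 * \<beta>\<^sup>2 * q\<^sup>2 \<le> 2 * \<beta>\<^sup>2 * 1"
    using assms by (intro mult_left_mono; simp)+
  then show ?thesis by simp
qed

text \<open>The supremum is finite and is approached at points \<open>q < 1\<close>, where the functional is real.\<close>

lemma SUP_B_TAP:
  assumes \<beta>: "\<beta> > 0"
  obtains b\<^sub>0 where "(SUP q \<in> {q \<in> {0..1}. \<beta> * (1 - q) \<le> 1 / sqrt 2}. B_TAP \<beta> h q) = ereal b\<^sub>0"
    "\<And>q. 0 \<le> q \<Longrightarrow> q < 1 \<Longrightarrow> \<beta> * (1 - q) \<le> 1 / sqrt 2 \<Longrightarrow> B_real \<beta> h q \<le> b\<^sub>0"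
    "\<And>\<epsilon>. \<epsilon> > 0 \<Longrightarrow> \<exists>q. 0 \<le> q \<and> q < 1 \<and> \<beta> * (1 - q) \<le> 1 / sqrt 2 \<and> b\<^sub>0 - \<epsilon> < B_real \<beta> h q"
proof -
  let ?Q = "{q \<in> {0..1}. \<beta> * (1 - q) \<le> 1 / sqrt 2}"
  define Z where "Z = (SUP q \<in> ?Q. B_TAP \<beta> h q)"
  have "Z \<le> ereal (sqrt (h\<^sup>2 + 2 * \<beta>\<^sup>2) + \<beta>\<^sup>2 / 2)"
    unfolding Z_def
  proof (rule SUP_least)
    fix q assume q: "q \<in> ?Q"
    show "B_TAP \<beta> h q \<le> ereal (sqrt (h\<^sup>2 + 2 * \<beta>\<^sup>2) + \<beta>\<^sup>2 / 2)"
    proof (cases "q = 1")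
      case False
      have "(1 - q)\<^sup>2 \<le> 1" using q by (simp add: power_le_one)
      then have "\<beta>\<^sup>2 / 2 * (1 - q)\<^sup>2 \<le> \<beta>\<^sup>2 / 2 * 1" by (intro mult_left_mono) auto
      moreover have "ln (1 - q) \<le> 0" using q False by simp
      moreover have "sqrt (h\<^sup>2 * q + 2 * \<beta>\<^sup>2 * q\<^sup>2) \<le> sqrt (h\<^sup>2 + 2 * \<beta>\<^sup>2)"
        by (rule field_term_le) (use q in auto)
      ultimately show ?thesis
        unfolding B_TAP_eq [OF False] B_real_def ereal_less_eq by linarith
    qed (simp add: B_TAP_def log_ext_def)
  qed
  \<comment> \<open>The left end of the range of \<open>q\<close>, which lies below \<open>1\<close>.\<close>
  define q\<^sub>1 where "q\<^sub>1 = max 0 (1 - 1 / (sqrt 2 * \<beta>))"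
  have q1: "0 \<le> q\<^sub>1" "q\<^sub>1 < 1" using \<beta> by (auto simp: q\<^sub>1_def)
  have "\<beta> * (1 - q\<^sub>1) \<le> \<beta> * (1 / (sqrt 2 * \<beta>))"
    using \<beta> by (intro mult_left_mono) (auto simp: q\<^sub>1_def)
  then have "q\<^sub>1 \<in> ?Q" using q1 \<beta> by simp
  then have "ereal (B_real \<beta> h q\<^sub>1) \<le> Z"
    unfolding Z_def using q1 by (intro SUP_upper2 [of q\<^sub>1]) (auto simp: B_TAP_eq)
  with \<open>Z \<le> _\<close> obtain b\<^sub>0 where b0: "Z = ereal b\<^sub>0" by (cases Z) auto
  show thesis
  proof
    show "(SUP q \<in> ?Q. B_TAP \<beta> h q) = ereal b\<^sub>0" using b0 by (simp add: Z_def)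
  next
    fix q assume q: "0 \<le> q" "q < 1" "\<beta> * (1 - q) \<le> 1 / sqrt 2"
    then have "ereal (B_real \<beta> h q) \<le> Z"
      unfolding Z_def by (intro SUP_upper2 [of q]) (auto simp: B_TAP_eq)
    then show "B_real \<beta> h q \<le> b\<^sub>0" using b0 by simp
  next
    fix \<epsilon> :: real assume "\<epsilon> > 0"
    then have "ereal (b\<^sub>0 - \<epsilon>) < Z" using b0 by simp
    then obtain q where q: "q \<in> ?Q" "ereal (b\<^sub>0 - \<epsilon>) < B_TAP \<beta> h q"
      unfolding Z_def less_SUP_iff by blast
    then have "q \<noteq> 1" by (auto simp: B_TAP_def log_ext_def)
    then show "\<exists>q. 0 \<le> q \<and> q < 1 \<and> \<beta> * (1 - q) \<le> 1 / sqrt 2 \<and> b\<^sub>0 - \<epsilon> < B_real \<beta> h q"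
      using q by (intro exI [of _ q]) (auto simp: B_TAP_eq)
  qed
qed

text \<open>The field and interaction terms of the limit are \<open>sqrt (A\<^sup>2 + B\<^sup>2)\<close> with \<open>A = h sqrt q\<close> and
  \<open>B = sqrt 2 \<beta> q\<close>, the maximum of \<open>A a + B b\<close> on the unit circle. The witness of the lower bound needs a
  positive component \<open>a\<close> along the field even if there is no field, so for \<open>A = 0\<close> the maximum is
  only approached.\<close>

lemma unit_vector_near_direction:
  fixes A B \<epsilon> :: real
  assumes AB: "A \<ge> 0" "B \<ge> 0" and \<epsilon>: "\<epsilon> > 0"
  obtains a b where "a > 0" "b \<ge> 0" "a\<^sup>2 + b\<^sup>2 = 1" "sqrt (A\<^sup>2 + B\<^sup>2) - \<epsilon> < A * a + B * b"
proof (cases "A = 0")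
  case False
  let ?S = "sqrt (A\<^sup>2 + B\<^sup>2)"
  have pos: "A\<^sup>2 + B\<^sup>2 > 0" using False by (simp add: sum_power2_gt_zero_iff)
  have "A * (A / ?S) + B * (B / ?S) = (A\<^sup>2 + B\<^sup>2) / ?S"
    by (simp add: power2_eq_square add_divide_distrib)
  also have "\<dots> = ?S" using pos by (simp add: real_div_sqrt)
  finally show thesis
    using that [of "A / ?S" "B / ?S"] False AB \<epsilon> pos
    by (simp add: power_divide add_divide_distrib [symmetric])
next
  case True
  define a where "a = min 1 (\<epsilon> / (B + 1))"
  have a: "0 < a" "a \<le> 1" "a * (B + 1) \<le> \<epsilon>"
  proof -
    show "0 < a" "a \<le> 1" using AB \<epsilon> by (auto simp: a_def)
    have "a \<le> \<epsilon> / (B + 1)" by (simp add: a_def)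
    then show "a * (B + 1) \<le> \<epsilon>" using AB by (simp add: pos_le_divide_eq)
  qed
  have "(1 - a)\<^sup>2 \<le> 1 - a\<^sup>2"
  proof -
    have "a * a \<le> a * 1" using a by (intro mult_left_mono) auto
    then show ?thesis by (simp add: power2_eq_square algebra_simps)
  qed
  then have "1 - a \<le> sqrt (1 - a\<^sup>2)" by (rule real_le_rsqrt)
  then have "B * (1 - a) \<le> B * sqrt (1 - a\<^sup>2)" using AB by (intro mult_left_mono) auto
  moreover have "a\<^sup>2 \<le> 1" using a by (simp add: power_le_one)
  moreover have "B * a < \<epsilon>" using a by (simp add: algebra_simps)
  ultimately show thesis
    using that [of a "sqrt (1 - a\<^sup>2)"] True a AB by (simp add: algebra_simps)
qed

section \<open>The TAP free energy of one realisation\<close>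

lemma countable_dense_subset:
  fixes S :: "'a::second_countable_topology set"
  obtains D where "countable D" "D \<subseteq> S" "\<And>U. open U \<Longrightarrow> U \<inter> S \<noteq> {} \<Longrightarrow> \<exists>x\<in>D. x \<in> U"
proof -
  obtain B :: "'a set set" where B: "countable B" "topological_basis B"
    using ex_countable_basis by blast
  define D where "D = (\<lambda>b. SOME x. x \<in> b \<inter> S) ` {b \<in> B. b \<inter> S \<noteq> {}}"
  have pick: "(SOME x. x \<in> b \<inter> S) \<in> b \<inter> S" if "b \<inter> S \<noteq> {}" for b
    using that by (simp only: some_in_eq not_False_eq_True)
  show thesis
  proof
    show "countable D" using B(1) by (auto simp: D_def intro: countable_subset [of _ B])
    show "D \<subseteq> S" using pick by (auto simp: D_def)
  next
    fix U :: "'a set" assume "open U" "U \<inter> S \<noteq> {}"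
    then obtain x where "x \<in> U" "x \<in> S" by blast
    obtain b where "b \<in> B" "x \<in> b" "b \<subseteq> U"
      using topological_basisE [OF B(2) \<open>open U\<close> \<open>x \<in> U\<close>] by metis
    then show "\<exists>y\<in>D. y \<in> U" using pick [of b] \<open>x \<in> S\<close> by (auto simp: D_def)
  qed
qed

text \<open>By continuity the supremum can be taken over a countable dense subset of \<open>S\<close>.\<close>

lemma borel_measurable_SUP_continuous:
  fixes f :: "'b::second_countable_topology \<Rightarrow> 'a \<Rightarrow> real"
  assumes cont: "\<And>\<omega>. \<omega> \<in> space M \<Longrightarrow> continuous_on S (\<lambda>m. f m \<omega>)"
    and meas: "\<And>m. m \<in> S \<Longrightarrow> f m \<in> borel_measurable M"
  shows "(\<lambda>\<omega>. SUP m\<in>S. ereal (f m \<omega>)) \<in> borel_measurable M"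
proof -
  obtain D where D: "countable D" "D \<subseteq> S" "\<And>U. open U \<Longrightarrow> U \<inter> S \<noteq> {} \<Longrightarrow> \<exists>x\<in>D. x \<in> U"
    by (rule countable_dense_subset [of S]) (rule that)
  have eq: "(SUP m\<in>S. ereal (f m \<omega>)) = (SUP m\<in>D. ereal (f m \<omega>))" if \<omega>: "\<omega> \<in> space M" for \<omega>
  proof (rule antisym)
    show "(SUP m\<in>S. ereal (f m \<omega>)) \<le> (SUP m\<in>D. ereal (f m \<omega>))"
    proof (rule SUP_least, rule dense_le)
      fix m x assume m: "m \<in> S" "x < ereal (f m \<omega>)"
      have "continuous_on S (\<lambda>m. ereal (f m \<omega>))"
        using cont [OF \<omega>] by (rule continuous_on_ereal)
      then obtain A where A: "open A" "A \<inter> S = (\<lambda>m. ereal (f m \<omega>)) -` {x<..} \<inter> S"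
        unfolding continuous_on_open_invariant by (metis open_greaterThan)
      then have "m \<in> A \<inter> S" using m by auto
      then obtain d where "d \<in> D" "d \<in> A" using D(3) A(1) by blast
      then have "x < ereal (f d \<omega>)" using A(2) D(2) by auto
      then show "x \<le> (SUP m\<in>D. ereal (f m \<omega>))"
        using \<open>d \<in> D\<close> by (intro SUP_upper2 [of d]) auto
    qed
    show "(SUP m\<in>D. ereal (f m \<omega>)) \<le> (SUP m\<in>S. ereal (f m \<omega>))"
      by (rule SUP_subset_mono [OF D(2)]) simp
  qed
  have "(\<lambda>\<omega>. SUP m\<in>D. ereal (f m \<omega>)) \<in> borel_measurable M"
    using D(1,2) meas by (intro borel_measurable_SUP) auto
  then show ?thesis using eq by (subst measurable_cong) auto
qed

lemma enorm_sq: "(enorm N m)\<^sup>2 = inner_on {1..N} m m"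
  by (simp add: L2_set_def inner_on_def power2_eq_square sum_nonneg)

lemma dotp_eq: "dotp N m x = inner_on {1..N} x m"
  by (simp add: dotp_def inner_on_def mult.commute)

lemma Ham_eq: "Ham J N m = sqrt (real N) * quad_form {1..N} (\<lambda>(i, j). J i j) m"
  by (simp add: Ham_def quad_form_def)

lemma continuous_on_H_TAP: "continuous_on {m. enorm N m < 1} (H_TAP \<beta> J N x)"
proof -
  have "0 < 1 - inner_on {1..N} m m" if "enorm N m < 1" for m
  proof -
    have "(enorm N m)\<^sup>2 < 1\<^sup>2" using that by (intro power_strict_mono) auto
    then show ?thesis unfolding enorm_sq by simp
  qed
  then show ?thesis
    unfolding H_TAP_def enorm_sq dotp_eq Ham_eq
    by (intro continuous_intros) (auto simp: less_imp_neq [THEN not_sym])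
qed

lemma H_TAP_scaled:
  assumes "N \<ge> 1" "\<And>m. dotp N m x = h * inner_on {1..N} u m"
  shows "H_TAP \<beta> J N x m = real N *
     (\<beta> * (quad_form {1..N} (\<lambda>(i, j). J i j) m / sqrt N) + h * inner_on {1..N} u m
      + 1 / 2 * ln (1 - inner_on {1..N} m m) + \<beta>\<^sup>2 / 2 * (1 - inner_on {1..N} m m)\<^sup>2)"
proof -
  have "real N * (Q / sqrt N) = real N / sqrt N * Q" for Q by simp
  then have Q: "real N * (Q / sqrt N) = sqrt N * Q" for Q by (simp add: real_div_sqrt)
  show ?thesis
    unfolding H_TAP_def enorm_sq assms(2) Ham_eq Q [symmetric]
    by (simp only: distrib_left mult_ac)
qed

text \<open>By the Cauchy-Schwarz inequality in the plane, the field term \<open>h p\<close> and the bound \<open>sqrt 2 \<beta> sqrt q * sqrt (q - p\<^sup>2)\<close>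
  on the interaction add up to at most \<open>sqrt (h\<^sup>2 q + 2 \<beta>\<^sup>2 q\<^sup>2)\<close>, with an error from \<open>s\<close> and \<open>\<eta>\<close>.\<close>

lemma H_TAP_le:
  assumes N: "N \<ge> 1" and x: "\<And>m. dotp N m x = h * inner_on {1..N} u m" and u: "inner_on {1..N} u u \<le> 1"
    and \<beta>: "\<beta> > 0" and h: "h \<ge> 0" and s: "s \<ge> 1" and \<eta>: "\<eta> \<ge> 0"
    and dom: "upper_dominated (s * sqrt (2 * real N)) (\<eta> * sqrt N) {1..N} u (\<lambda>(i, j). J i j)"
    and m: "enorm N m < 1"
  shows "H_TAP \<beta> J N x m \<le> real N * (B_real \<beta> h ((enorm N m)\<^sup>2) + (s - 1) * sqrt (h\<^sup>2 + 2 * \<beta>\<^sup>2) + \<beta> * \<eta>)"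
proof -
  let ?I = "{1..N}"
  define q where "q = inner_on ?I m m"
  define p where "p = inner_on ?I u m"
  define S where "S = sqrt (h\<^sup>2 * q + 2 * \<beta>\<^sup>2 * q\<^sup>2)"
  have "(enorm N m)\<^sup>2 \<le> 1\<^sup>2" using m by (intro power_mono) auto
  then have q: "0 \<le> q" "q \<le> 1" unfolding q_def enorm_sq by (simp_all add: inner_on_self_nonneg)
  have p: "p\<^sup>2 \<le> q"
    using inner_on_Cauchy_Schwarz [of ?I u m] mult_right_mono [OF u q(1)] by (simp add: p_def q_def)
  have "quad_form ?I (\<lambda>(i, j). J i j) m / sqrt N
      \<le> (s * sqrt (2 * real N) * sqrt q * sqrt (q - p\<^sup>2) + \<eta> * sqrt N * q) / sqrt N"
    using dom by (intro divide_right_mono) (auto simp: upper_dominated_def q_def p_def)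
  also have "\<dots> = s * sqrt 2 * sqrt q * sqrt (q - p\<^sup>2) + \<eta> * q"
    using N by (simp add: real_sqrt_mult add_divide_distrib)
  finally have "\<beta> * (quad_form ?I (\<lambda>(i, j). J i j) m / sqrt N)
      \<le> \<beta> * (s * sqrt 2 * sqrt q * sqrt (q - p\<^sup>2) + \<eta> * q)"
    using \<beta> by (intro mult_left_mono) auto
  then have "\<beta> * (quad_form ?I (\<lambda>(i, j). J i j) m / sqrt N) + h * p
      \<le> (h * p + (\<beta> * s * sqrt 2 * sqrt q) * sqrt (q - p\<^sup>2)) + \<beta> * \<eta> * q"
    by (simp add: algebra_simps)
  also have "h * p + (\<beta> * s * sqrt 2 * sqrt q) * sqrt (q - p\<^sup>2)
      \<le> sqrt (h\<^sup>2 + (\<beta> * s * sqrt 2 * sqrt q)\<^sup>2) * sqrt (p\<^sup>2 + (sqrt (q - p\<^sup>2))\<^sup>2)"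
    by (rule mult_add_le_sqrt_mult_sqrt)
  also have "\<dots> = sqrt (h\<^sup>2 * q + s\<^sup>2 * (2 * \<beta>\<^sup>2 * q\<^sup>2))"
    using p q by (simp add: power_mult_distrib algebra_simps power2_eq_square flip: real_sqrt_mult)
  also have "\<dots> \<le> sqrt (s\<^sup>2 * (h\<^sup>2 * q + 2 * \<beta>\<^sup>2 * q\<^sup>2))"
  proof -
    have "1 \<le> s\<^sup>2" using s by (simp add: one_le_power)
    then have "1 * (h\<^sup>2 * q) \<le> s\<^sup>2 * (h\<^sup>2 * q)" using q by (intro mult_right_mono) auto
    then show ?thesis by (simp add: algebra_simps)
  qed
  also have "\<dots> = s * S" using s by (simp add: real_sqrt_mult S_def)
  also have "\<beta> * \<eta> * q \<le> \<beta> * \<eta> * 1" using \<beta> \<eta> q by (intro mult_left_mono) auto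
  also have "s * S = S + (s - 1) * S" by (simp add: algebra_simps)
  also have "(s - 1) * S \<le> (s - 1) * sqrt (h\<^sup>2 + 2 * \<beta>\<^sup>2)"
    using field_term_le [OF q] s by (intro mult_left_mono) (auto simp: S_def)
  finally have "\<beta> * (quad_form ?I (\<lambda>(i, j). J i j) m / sqrt N) + h * p
      \<le> S + (s - 1) * sqrt (h\<^sup>2 + 2 * \<beta>\<^sup>2) + \<beta> * \<eta>" by simp
  then show ?thesis
    unfolding H_TAP_scaled [OF N x] enorm_sq B_real_def
    by (intro mult_left_mono) (auto simp: q_def p_def S_def)
qed

text \<open>A witness is homogeneous and can be rescaled to any prescribed length.\<close>

lemma H_TAP_ge:
  assumes N: "N \<ge> 1" and x: "\<And>m. dotp N m x = h * inner_on {1..N} u m"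
    and \<beta>: "\<beta> > 0" and h: "h \<ge> 0" and q: "0 \<le> q"
    and wit: "lower_witness \<alpha> (sqrt N * e) {1..N} u (\<lambda>(i, j). J i j)"
  obtains m where "m \<in> Rn N" "(enorm N m)\<^sup>2 = q"
    "H_TAP \<beta> J N x m \<ge> real N * (\<beta> * q * e + h * sqrt q * \<alpha> + 1 / 2 * ln (1 - q) + \<beta>\<^sup>2 / 2 * (1 - q)\<^sup>2)"
proof -
  let ?I = "{1..N}"
  obtain m where m: "\<alpha> * sqrt (inner_on ?I m m) < inner_on ?I u m"
    "sqrt N * e * inner_on ?I m m < quad_form ?I (\<lambda>(i, j). J i j) m"
    using wit by (auto simp: lower_witness_def)
  define n where "n = inner_on ?I m m"
  have "n \<noteq> 0"
    using m(1) inner_on_Cauchy_Schwarz [of ?I u m] by (auto simp: n_def)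
  then have n: "n > 0" using inner_on_self_nonneg [of ?I m] by (simp add: n_def)
  define t where "t = sqrt (q / n)"
  have t: "t \<ge> 0" "t\<^sup>2 * n = q" "t * sqrt n = sqrt q"
    using q n by (auto simp: t_def real_sqrt_divide power_divide)
  define m' where "m' = restrict (\<lambda>i. t * m i) ?I"
  have restr: "inner_on ?I y m' = t * inner_on ?I y m" for y
    by (auto simp: inner_on_def m'_def sum_distrib_left intro!: sum.cong)
  have "inner_on ?I m' m' = t * inner_on ?I m' m" by (rule restr)
  also have "inner_on ?I m' m = inner_on ?I m m'" by (simp add: inner_on_def mult.commute)
  also have "t * \<dots> = t\<^sup>2 * n" by (simp only: restr n_def power2_eq_square mult.assoc)
  finally have norm: "inner_on ?I m' m' = q" by (simp add: t)
  have "quad_form ?I (\<lambda>(i, j). J i j) m' = quad_form ?I (\<lambda>(i, j). J i j) (\<lambda>i. t * m i)"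
    by (auto simp: quad_form_def m'_def intro!: sum.cong)
  then have "quad_form ?I (\<lambda>(i, j). J i j) m' = t\<^sup>2 * quad_form ?I (\<lambda>(i, j). J i j) m"
    by (simp add: quad_form_scale)
  moreover have "t\<^sup>2 * (sqrt N * e * n) \<le> t\<^sup>2 * quad_form ?I (\<lambda>(i, j). J i j) m"
    using m(2) by (intro mult_left_mono) (auto simp: n_def)
  moreover have "t\<^sup>2 * (sqrt N * e * n) = sqrt N * (e * q)"
    unfolding t(2) [symmetric] by (simp only: mult_ac)
  ultimately have "sqrt N * (e * q) \<le> quad_form ?I (\<lambda>(i, j). J i j) m'" by linarith
  then have "sqrt N * (e * q) / sqrt N \<le> quad_form ?I (\<lambda>(i, j). J i j) m' / sqrt N"
    by (intro divide_right_mono) simp_all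
  then have "\<beta> * (e * q) \<le> \<beta> * (quad_form ?I (\<lambda>(i, j). J i j) m' / sqrt N)"
    using N \<beta> by (intro mult_left_mono) auto
  moreover have "t * (\<alpha> * sqrt n) \<le> t * inner_on ?I u m"
    using m(1) t(1) by (intro mult_left_mono) (auto simp: n_def)
  then have "\<alpha> * (t * sqrt n) \<le> inner_on ?I u m'" unfolding restr by (simp only: mult_ac)
  then have "h * (\<alpha> * sqrt q) \<le> h * inner_on ?I u m'"
    using h unfolding t(3) by (intro mult_left_mono) auto
  ultimately have "H_TAP \<beta> J N x m' \<ge> real N * (\<beta> * q * e + h * sqrt q * \<alpha> + 1 / 2 * ln (1 - q) + \<beta>\<^sup>2 / 2 * (1 - q)\<^sup>2)"
    unfolding H_TAP_scaled [OF N x] norm by (intro mult_left_mono) (auto simp: mult_ac)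
  moreover have "m' \<in> Rn N" by (simp add: m'_def Rn_def)
  moreover have "(enorm N m')\<^sup>2 = q" unfolding enorm_sq by (rule norm)
  ultimately show thesis using that by blast
qed


section \<open>Convergence in probability\<close>

text \<open>Events that only read the first \<open>N\<close> rows and columns have the same probability under the disorder
  as under the Gaussian product measure.\<close>

lemma (in prob_space) disorder_prob:
  fixes J :: "nat \<Rightarrow> nat \<Rightarrow> 'a \<Rightarrow> real"
  assumes indep: "indep_vars (\<lambda>_. borel) (\<lambda>(i, j). J i j) ({1..} \<times> {1..})"
    and gauss: "\<And>i j. i \<ge> 1 \<Longrightarrow> j \<ge> 1 \<Longrightarrow> distributed M lborel (J i j) std_normal_density"
    and N: "N \<ge> 1"
    and P: "{X \<in> space (gauss_matrix {1..N}). P X} \<in> sets (gauss_matrix {1..N})"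
    and ext: "\<And>X Y. (\<And>i j. i \<in> {1..N} \<Longrightarrow> j \<in> {1..N} \<Longrightarrow> X (i, j) = Y (i, j)) \<Longrightarrow> P X \<longleftrightarrow> P Y"
  shows "{\<omega> \<in> space M. P (\<lambda>(i, j). J i j \<omega>)} \<in> events"
    and "prob {\<omega> \<in> space M. P (\<lambda>(i, j). J i j \<omega>)}
       = measure (gauss_matrix {1..N}) {X \<in> space (gauss_matrix {1..N}). P X}"
proof -
  let ?X = "{1..N} \<times> {1..N}" and ?G = "gauss_matrix {1..N}"
  let ?J = "\<lambda>z. (case z of (i, j) \<Rightarrow> J i j)"
  let ?\<Phi> = "\<lambda>\<omega>. \<lambda>z\<in>?X. ?J z \<omega>"
  have rv: "random_variable borel (?J z)" if "z \<in> ?X" for z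
    using gauss [of "fst z" "snd z"] that by (auto simp: distributed_def split: prod.splits)
  have law: "distr M borel (?J z) = gauss" if "z \<in> ?X" for z
  proof -
    have "distr M lborel (?J z) = gauss"
      using gauss [of "fst z" "snd z"] that
      by (auto simp: gauss_def distributed_distr_eq_density split: prod.splits)
    then show ?thesis by (simp cong: distr_cong)
  qed
  have "indep_vars (\<lambda>_. borel) ?J ?X"
    by (rule indep_vars_subset [OF indep]) auto
  then have "distr M (PiM ?X (\<lambda>_. borel)) ?\<Phi> = (\<Pi>\<^sub>M z\<in>?X. distr M borel (?J z))"
    using N rv by (subst (asm) indep_vars_iff_distr_eq_PiM') auto
  also have "\<dots> = ?G" by (rule PiM_cong) (simp_all add: law)
  finally have d: "distr M (PiM ?X (\<lambda>_. borel)) ?\<Phi> = ?G" .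
  have sets: "sets ?G = sets (PiM ?X (\<lambda>_. borel))" by (rule sets_PiM_cong) simp_all
  have \<Phi>: "?\<Phi> \<in> M \<rightarrow>\<^sub>M PiM ?X (\<lambda>_. borel)" by (rule measurable_restrict) (rule rv)
  let ?S = "{X \<in> space ?G. P X}"
  have "P (?\<Phi> \<omega>) \<longleftrightarrow> P (\<lambda>(i, j). J i j \<omega>)" for \<omega> by (rule ext) simp
  moreover have "?\<Phi> \<omega> \<in> space ?G" if "\<omega> \<in> space M" for \<omega> by (simp add: space_PiM)
  ultimately have eq: "{\<omega> \<in> space M. P (\<lambda>(i, j). J i j \<omega>)} = ?\<Phi> -` ?S \<inter> space M" by auto
  show "{\<omega> \<in> space M. P (\<lambda>(i, j). J i j \<omega>)} \<in> events"
    unfolding eq by (rule measurable_sets [OF \<Phi>]) (use P sets in simp)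
  show "prob {\<omega> \<in> space M. P (\<lambda>(i, j). J i j \<omega>)} = measure ?G ?S"
    unfolding eq by (subst measure_distr [OF \<Phi>, symmetric]) (use P sets d in simp_all)
qed

lemma quad_form_cong:
  "(\<And>i j. i \<in> I \<Longrightarrow> j \<in> I \<Longrightarrow> X (i, j) = Y (i, j)) \<Longrightarrow> quad_form I X m = quad_form I Y m"
  by (simp add: quad_form_def)

text \<open>Without a field any unit vector serves as its direction.\<close>

lemma field_direction:
  assumes N: "N \<ge> 1" and x: "enorm N x = h"
  obtains u where "inner_on {1..N} u u = 1" "\<And>m. dotp N m x = h * inner_on {1..N} u m"
proof (cases "h = 0")
  case True
  then have "\<forall>i\<in>{1..N}. x i = 0" using x by (simp add: L2_set_eq_0_iff)
  moreover have "inner_on {1..N} (\<lambda>i. if i = 1 then 1 else 0) (\<lambda>i. if i = 1 then 1 else 0) = 1"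
    using N by (simp add: inner_on_def if_distrib cong: if_cong)
  ultimately show thesis using True by (intro that) (auto simp: dotp_def)
next
  case False
  have "inner_on {1..N} x x = h\<^sup>2" using enorm_sq [of x N] x by (simp only:)
  then have "inner_on {1..N} (\<lambda>i. x i / h) (\<lambda>i. x i / h) = 1"
    using False by (simp add: inner_on_div_self)
  then show thesis by (rule that) (use False in \<open>simp add: dotp_eq inner_on_div\<close>)
qed

lemma upper_dominated_cong:
  "(\<And>i j. i \<in> I \<Longrightarrow> j \<in> I \<Longrightarrow> X (i, j) = Y (i, j)) \<Longrightarrow>
    upper_dominated \<kappa> \<epsilon> I u X \<longleftrightarrow> upper_dominated \<kappa> \<epsilon> I u Y"
  unfolding upper_dominated_def by (simp cong: quad_form_cong)

lemma lower_witness_cong: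
  "(\<And>i j. i \<in> I \<Longrightarrow> j \<in> I \<Longrightarrow> X (i, j) = Y (i, j)) \<Longrightarrow>
    lower_witness \<alpha> e I u X \<longleftrightarrow> lower_witness \<alpha> e I u Y"
  unfolding lower_witness_def by (simp cong: quad_form_cong)

text \<open>The loss comes from the lengths of the cross parts (\<open>s < 1\<close>) and from stopping after \<open>k\<close> steps. With \<open>s = 1 - \<delta>\<close>
  and \<open>b ^ (2 k) \<le> \<delta>\<close> both coefficients are at least \<open>s\<^sup>3 \<ge> 1 - 3 \<delta>\<close>.\<close>

lemma parameters_for_lower_bound:
  fixes A B a b \<epsilon> :: real
  assumes "A \<ge> 0" "B \<ge> 0" "a \<ge> 0" "0 \<le> b" "b < 1" "\<epsilon> > 0"
  obtains s k where "0 < s" "s < 1"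
    "A * a + B * b - \<epsilon> \<le> s * (A * a) + s\<^sup>2 * (1 - b ^ (2 * k)) * (B * b)"
proof -
  define X where "X = A * a + B * b"
  have AB: "0 \<le> A * a" "0 \<le> B * b" "0 \<le> X" using assms by (auto simp: X_def)
  define \<delta> where "\<delta> = min (1 / 2) (\<epsilon> / (3 * (X + 1)))"
  have "0 < \<delta>" using assms AB by (simp add: \<delta>_def)
  moreover have "\<delta> \<le> 1 / 2" "\<delta> \<le> \<epsilon> / (3 * (X + 1))"
    unfolding \<delta>_def by (rule min.cobounded1, rule min.cobounded2)
  ultimately have \<delta>: "0 < \<delta>" "\<delta> \<le> 1 / 2" "\<delta> \<le> \<epsilon> / (3 * (X + 1))" .
  have "\<delta> * (3 * (X + 1)) \<le> \<epsilon>" using \<delta>(3) AB by (simp add: pos_le_divide_eq)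
  then have \<delta>X: "3 * \<delta> * X \<le> \<epsilon>" using \<delta>(1) by (simp add: algebra_simps)
  define s where "s = 1 - \<delta>"
  have s: "0 < s" "s < 1" using \<delta> by (auto simp: s_def)
  obtain k where "b ^ k < \<delta>" using real_arch_pow_inv [OF \<delta>(1) assms(5)] by blast
  moreover have "b ^ (2 * k) \<le> b ^ k" using assms by (intro power_decreasing) auto
  ultimately have k: "s \<le> 1 - b ^ (2 * k)" by (simp add: s_def)
  have s3: "1 - 3 * \<delta> \<le> s ^ 3"
    using Bernoulli_inequality [of "- \<delta>" 3] \<delta> by (simp add: s_def)
  have "s ^ 3 \<le> s ^ 1" using s by (intro power_decreasing) auto
  then have "s ^ 3 * (A * a) \<le> s * (A * a)" using AB by (intro mult_right_mono) auto
  moreover have "s ^ 3 \<le> s\<^sup>2 * (1 - b ^ (2 * k))"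
    using mult_left_mono [OF k, of "s\<^sup>2"] by (simp add: power3_eq_cube power2_eq_square mult.assoc)
  then have "s ^ 3 * (B * b) \<le> s\<^sup>2 * (1 - b ^ (2 * k)) * (B * b)" using AB by (intro mult_right_mono) auto
  moreover have "(1 - 3 * \<delta>) * X \<le> s ^ 3 * X" using s3 AB by (intro mult_right_mono) auto
  ultimately have "X - \<epsilon> \<le> s * (A * a) + s\<^sup>2 * (1 - b ^ (2 * k)) * (B * b)"
    using \<delta>X by (simp add: X_def algebra_simps)
  then show thesis using that [OF s] by (simp add: X_def)
qed

theorem lemma2:
  fixes M :: "'a measure"
    and J :: "nat \<Rightarrow> nat \<Rightarrow> 'a \<Rightarrow> real"
    and \<beta> h :: real
    and hv :: "nat \<Rightarrow> nat \<Rightarrow> real"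
  assumes "prob_space M"
    and "prob_space.indep_vars M (\<lambda>_. borel) (\<lambda>(i, j). J i j) ({1..} \<times> {1..})"
    and "\<And>i j. i \<ge> 1 \<Longrightarrow> j \<ge> 1 \<Longrightarrow> distributed M lborel (J i j) std_normal_density"
    and "\<beta> > 0"
    and "h \<ge> 0"
    and "\<And>N. N \<ge> 1 \<Longrightarrow> hv N \<in> Rn N"
    and "\<And>N. N \<ge> 1 \<Longrightarrow> enorm N (hv N) = h"
  shows "tendsto_zero_in_prob M (\<lambda>N \<omega>.
    \<bar>ereal (1 / real N) *
        (SUP m \<in> {m \<in> Rn N. enorm N m < 1 \<and> beta_eff \<beta> N m \<le> 1 / sqrt 2}.
           ereal (H_TAP \<beta> (\<lambda>i j. J i j \<omega>) N (hv N) m))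
     - (SUP q \<in> {q \<in> {0..1}. \<beta> * (1 - q) \<le> 1 / sqrt 2}. B_TAP \<beta> h q)\<bar>)"
proof -
  interpret prob_space M by fact
  note indep = assms(2) and gauss = assms(3) and \<beta> = assms(4) and h = assms(5) and hv = assms(7)
  obtain b\<^sub>0 where b0: "(SUP q \<in> {q \<in> {0..1}. \<beta> * (1 - q) \<le> 1 / sqrt 2}. B_TAP \<beta> h q) = ereal b\<^sub>0"
    "\<And>q. 0 \<le> q \<Longrightarrow> q < 1 \<Longrightarrow> \<beta> * (1 - q) \<le> 1 / sqrt 2 \<Longrightarrow> B_real \<beta> h q \<le> b\<^sub>0"
    "\<And>\<epsilon>. \<epsilon> > 0 \<Longrightarrow> \<exists>q. 0 \<le> q \<and> q < 1 \<and> \<beta> * (1 - q) \<le> 1 / sqrt 2 \<and> b\<^sub>0 - \<epsilon> < B_real \<beta> h q"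
    by (rule SUP_B_TAP [OF \<beta>, of h]) (rule that)
  define S where "S N = {m \<in> Rn N. enorm N m < 1 \<and> beta_eff \<beta> N m \<le> 1 / sqrt 2}" for N
  define H where "H N m \<omega> = H_TAP \<beta> (\<lambda>i j. J i j \<omega>) N (hv N) m" for N m \<omega>
  define X where "X N \<omega> = ereal (1 / real N) * (SUP m\<in>S N. ereal (H N m \<omega>))" for N \<omega>
  have X_meas [measurable]: "X N \<in> borel_measurable M" for N
  proof -
    have J: "J i j \<in> borel_measurable M" if "i \<in> {1..N}" "j \<in> {1..N}" for i j
      using gauss [of i j] that by (auto simp: distributed_def)
    have "(\<lambda>\<omega>. SUP m\<in>S N. ereal (H N m \<omega>)) \<in> borel_measurable M"
    proof (rule borel_measurable_SUP_continuous)
      fix \<omega>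
      show "continuous_on (S N) (\<lambda>m. H N m \<omega>)"
        unfolding H_def by (rule continuous_on_subset [OF continuous_on_H_TAP]) (auto simp: S_def)
    next
      fix m
      show "H N m \<in> borel_measurable M"
        unfolding H_def H_TAP_def Ham_def
        by (intro borel_measurable_add borel_measurable_times borel_measurable_sum J borel_measurable_const)
    qed
    then show ?thesis unfolding X_def by (rule borel_measurable_ereal_times [OF borel_measurable_const])
  qed
  have "(\<lambda>N. prob {\<omega> \<in> space M. ereal \<epsilon> < \<bar>X N \<omega> - ereal b\<^sub>0\<bar>}) \<longlonglongrightarrow> 0" if \<epsilon>: "\<epsilon> > 0" for \<epsilon> :: real
  proof -
    define C where "C = sqrt (h\<^sup>2 + 2 * \<beta>\<^sup>2)"
    have C: "C \<ge> 0" by (simp add: C_def)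
    \<comment> \<open>Errors of the upper bound: \<open>(s\<^sub>1 - 1) C \<le> \<epsilon> / 2\<close> and \<open>\<beta> \<eta> = \<epsilon> / 6\<close>. Errors of the lower bound: \<open>\<epsilon> / 3\<close>
      for each of the choices of \<open>q\<close> and of \<open>(a, b)\<close>, \<open>\<epsilon> / 6\<close> for that of \<open>s, k\<close>, and \<open>\<beta> \<eta>\<close>.\<close>
    define s\<^sub>1 where "s\<^sub>1 = 1 + \<epsilon> / (2 * (C + 1))"
    define \<eta> where "\<eta> = \<epsilon> / (6 * \<beta>)"
    have \<eta>: "\<eta> > 0" "\<beta> * \<eta> = \<epsilon> / 6" using \<epsilon> \<beta> by (auto simp: \<eta>_def)
    have s1: "s\<^sub>1 > 1" using \<epsilon> C by (simp add: s\<^sub>1_def)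
    have "\<epsilon> * C \<le> \<epsilon> * (C + 1)" using \<epsilon> by simp
    then have s1C: "(s\<^sub>1 - 1) * C \<le> \<epsilon> / 2" using C by (simp add: s\<^sub>1_def field_simps)
    obtain q where q: "0 \<le> q" "q < 1" "\<beta> * (1 - q) \<le> 1 / sqrt 2" "b\<^sub>0 - \<epsilon> / 3 < B_real \<beta> h q"
      using b0(3) [of "\<epsilon> / 3"] \<epsilon> by auto
    define A where "A = h * sqrt q"
    define B where "B = sqrt 2 * \<beta> * q"
    have AB: "A \<ge> 0" "B \<ge> 0" using h \<beta> q by (auto simp: A_def B_def)
    have AB2: "A\<^sup>2 + B\<^sup>2 = h\<^sup>2 * q + 2 * \<beta>\<^sup>2 * q\<^sup>2"
      using q by (simp add: A_def B_def power_mult_distrib)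
    obtain a b where ab: "a > 0" "b \<ge> 0" "a\<^sup>2 + b\<^sup>2 = 1" "sqrt (A\<^sup>2 + B\<^sup>2) - \<epsilon> / 3 < A * a + B * b"
      using unit_vector_near_direction [OF AB, of "\<epsilon> / 3"] \<epsilon> by auto
    have "a\<^sup>2 > 0" using ab(1) by simp
    then have "b\<^sup>2 < 1\<^sup>2" using ab(3) unfolding one_power2 by linarith
    then have b1: "b < 1" by (rule power2_less_imp_less) simp
    obtain s k where s: "0 < s" "s < 1"
      "A * a + B * b - \<epsilon> / 6 \<le> s * (A * a) + s\<^sup>2 * (1 - b ^ (2 * k)) * (B * b)"
      using parameters_for_lower_bound [of A B a b "\<epsilon> / 6"] AB ab b1 \<epsilon> by auto
    define e where "e = s\<^sup>2 * (1 - b ^ (2 * k)) * sqrt 2 * b - \<eta>"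
    have wit_value: "b\<^sub>0 - \<epsilon> \<le> \<beta> * q * e + h * sqrt q * (s * a) + 1 / 2 * ln (1 - q) + \<beta>\<^sup>2 / 2 * (1 - q)\<^sup>2"
    proof -
      have "\<beta> * q * e + h * sqrt q * (s * a)
          = s * (A * a) + s\<^sup>2 * (1 - b ^ (2 * k)) * (B * b) - \<beta> * \<eta> * q"
        by (simp add: e_def A_def B_def algebra_simps)
      moreover have "\<beta> * \<eta> * q \<le> \<epsilon> / 6 * 1"
        unfolding \<eta>(2) using q \<epsilon> by (intro mult_left_mono) auto
      ultimately show ?thesis using s(3) ab(4) q(4) \<epsilon> unfolding AB2 B_real_def by linarith
    qed
    define U where "U N = real N * (sqrt 2 * exp (- \<eta>\<^sup>2 / 4) ^ N + tail_rate (s\<^sub>1\<^sup>2) ^ N)" for N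
    define L where "L N = Suc k * (sqrt 2 * exp (- \<eta>\<^sup>2 / 4) ^ N + tail_rate (s\<^sup>2) ^ N / s ^ Suc k)" for N
    have bound: "prob {\<omega> \<in> space M. ereal \<epsilon> < \<bar>X N \<omega> - ereal b\<^sub>0\<bar>} \<le> U N + L N" if N: "N > k" for N
    proof -
      let ?I = "{1..N}"
      have N1: "N \<ge> 1" using N by simp
      obtain u where u: "inner_on ?I u u = 1" "\<And>m. dotp N m (hv N) = h * inner_on ?I u m"
        using field_direction [OF N1 hv [OF N1]] by blast
      let ?dom = "upper_dominated (s\<^sub>1 * sqrt (2 * real N)) (\<eta> * sqrt N) ?I u"
      let ?wit = "lower_witness (s * a) (sqrt N * e) ?I u"
      let ?E1 = "{\<omega> \<in> space M. \<not> ?dom (\<lambda>(i, j). J i j \<omega>)}"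
      let ?E2 = "{\<omega> \<in> space M. \<not> ?wit (\<lambda>(i, j). J i j \<omega>)}"
      note E1 = disorder_prob [OF indep gauss N1 sets_upper_dominated, OF _ _ arg_cong [where f = Not, OF upper_dominated_cong]]
      note E2 = disorder_prob [OF indep gauss N1 sets_lower_witness, OF _ _ arg_cong [where f = Not, OF lower_witness_cong]]
      have E1_sets: "?E1 \<in> events" by (rule E1)
      have E2_sets: "?E2 \<in> events" by (rule E2)
      have E1_prob: "prob ?E1 = measure (gauss_matrix ?I) {X \<in> space (gauss_matrix ?I). \<not> ?dom X}"
        by (rule E1)
      have E2_prob: "prob ?E2 = measure (gauss_matrix ?I) {X \<in> space (gauss_matrix ?I). \<not> ?wit X}"
        by (rule E2)
      have "prob ?E1 \<le> U N"
        unfolding U_def E1_prob by (rule upper_dominated_iid) (use s1 \<eta> u N1 in auto)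
      moreover have "prob ?E2 \<le> L N"
        unfolding L_def E2_prob unfolding e_def by (rule lower_witness_iid) (use s \<eta> ab u N in auto)
      moreover have "{\<omega> \<in> space M. ereal \<epsilon> < \<bar>X N \<omega> - ereal b\<^sub>0\<bar>} \<subseteq> ?E1 \<union> ?E2"
      proof (rule ccontr)
        assume "\<not> ?thesis"
        then obtain \<omega> where \<omega>: "\<omega> \<in> space M" "ereal \<epsilon> < \<bar>X N \<omega> - ereal b\<^sub>0\<bar>"
          and dom: "?dom (\<lambda>(i, j). J i j \<omega>)" and wit: "?wit (\<lambda>(i, j). J i j \<omega>)" by blast
        have scale: "ereal (1 / real N) * ereal (real N * y) = ereal y" for y using N1 by simp
        have "(SUP m\<in>S N. ereal (H N m \<omega>)) \<le> ereal (real N * (b\<^sub>0 + \<epsilon>))"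
        proof (rule SUP_least)
          fix m assume m: "m \<in> S N"
          then have lt: "enorm N m < 1" by (simp add: S_def)
          then have "(enorm N m)\<^sup>2 < 1\<^sup>2" by (intro power_strict_mono) auto
          then have "B_real \<beta> h ((enorm N m)\<^sup>2) \<le> b\<^sub>0"
            using m by (intro b0(2)) (auto simp: S_def beta_eff_def)
          moreover have "H N m \<omega> \<le> real N * (B_real \<beta> h ((enorm N m)\<^sup>2) + (s\<^sub>1 - 1) * C + \<beta> * \<eta>)"
            unfolding H_def C_def
            by (rule H_TAP_le [OF N1 u(2) _ \<beta> h _ _ dom lt]) (use u s1 \<eta> in auto)
          ultimately have "H N m \<omega> \<le> real N * (b\<^sub>0 + \<epsilon>)"
            using s1C \<eta>(2) \<epsilon> by (elim order_trans) (intro mult_left_mono, auto)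
          then show "ereal (H N m \<omega>) \<le> ereal (real N * (b\<^sub>0 + \<epsilon>))" by simp
        qed
        then have "X N \<omega> \<le> ereal (1 / real N) * ereal (real N * (b\<^sub>0 + \<epsilon>))"
          unfolding X_def by (rule ereal_mult_left_mono) simp
        then have le: "X N \<omega> \<le> ereal (b\<^sub>0 + \<epsilon>)" unfolding scale .
        obtain m where m: "m \<in> Rn N" "(enorm N m)\<^sup>2 = q"
          "H N m \<omega> \<ge> real N * (\<beta> * q * e + h * sqrt q * (s * a) + 1 / 2 * ln (1 - q) + \<beta>\<^sup>2 / 2 * (1 - q)\<^sup>2)"
          by (rule H_TAP_ge [OF N1 u(2) \<beta> h q(1) wit]) (rule that [unfolded H_def])
        have "(enorm N m)\<^sup>2 < 1\<^sup>2" using m(2) q by simp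
        then have "enorm N m < 1" by (rule power2_less_imp_less) simp
        then have mS: "m \<in> S N" using m q by (simp add: S_def beta_eff_def)
        have "real N * (b\<^sub>0 - \<epsilon>) \<le> H N m \<omega>"
          using m(3) mult_left_mono [OF wit_value, of "real N"] by simp
        then have "ereal (real N * (b\<^sub>0 - \<epsilon>)) \<le> (SUP m\<in>S N. ereal (H N m \<omega>))"
          using mS by (intro SUP_upper2 [of m]) auto
        then have "ereal (1 / real N) * ereal (real N * (b\<^sub>0 - \<epsilon>)) \<le> X N \<omega>"
          unfolding X_def by (rule ereal_mult_left_mono) simp
        then have "ereal (b\<^sub>0 - \<epsilon>) \<le> X N \<omega>" unfolding scale .
        with le have "\<bar>X N \<omega> - ereal b\<^sub>0\<bar> \<le> ereal \<epsilon>" by (cases "X N \<omega>") auto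
        with \<omega>(2) show False by simp
      qed
      then have "prob {\<omega> \<in> space M. ereal \<epsilon> < \<bar>X N \<omega> - ereal b\<^sub>0\<bar>} \<le> prob (?E1 \<union> ?E2)"
        by (rule finite_measure_mono) (rule sets.Un [OF E1_sets E2_sets])
      moreover have "prob (?E1 \<union> ?E2) \<le> prob ?E1 + prob ?E2" by (rule measure_Un_le [OF E1_sets E2_sets])
      ultimately show ?thesis by linarith
    qed
    have x: "norm (exp (- \<eta>\<^sup>2 / 4)) < 1" using \<eta> by simp
    have y: "norm (tail_rate (s\<^sub>1\<^sup>2)) < 1"
      using tail_rate_bounds [of "s\<^sub>1\<^sup>2"] s1 by (simp add: power2_eq_1_iff)
    have z: "norm (tail_rate (s\<^sup>2)) < 1"
      using tail_rate_bounds [of "s\<^sup>2"] s by (simp add: power2_eq_1_iff)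
    have "(\<lambda>N. sqrt 2 * (real N * exp (- \<eta>\<^sup>2 / 4) ^ N) + real N * tail_rate (s\<^sub>1\<^sup>2) ^ N
        + Suc k * (sqrt 2 * exp (- \<eta>\<^sup>2 / 4) ^ N + tail_rate (s\<^sup>2) ^ N / s ^ Suc k))
        \<longlonglongrightarrow> sqrt 2 * 0 + 0 + Suc k * (sqrt 2 * 0 + 0 / s ^ Suc k)"
      by (intro tendsto_intros powser_times_n_limit_0 LIMSEQ_power_zero x y z) (use s in auto)
    then have lim: "(\<lambda>N. U N + L N) \<longlonglongrightarrow> 0"
      by (simp add: U_def L_def algebra_simps)
    show ?thesis
      by (rule tendsto_sandwich [OF _ _ tendsto_const lim])
        (use bound in \<open>auto simp: eventually_sequentially intro!: exI [of _ "Suc k"]\<close>)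
  qed
  moreover have "(\<lambda>\<omega>. \<bar>X N \<omega> - ereal b\<^sub>0\<bar>) \<in> borel_measurable M" for N by measurable
  ultimately have "tendsto_zero_in_prob M (\<lambda>N \<omega>. \<bar>X N \<omega> - ereal b\<^sub>0\<bar>)"
    unfolding tendsto_zero_in_prob_def by simp
  then show ?thesis by (simp only: b0(1) X_def S_def H_def)
qed

end
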